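(* Let $q\in[0,1)$. Let $\{\tilde T^{\mathrm{qT}}(\mathsf t)\}_{\mathsf t\ge0}$ be the Markov semigroup of the homogeneous continuous-time $q$-TASEP on $\mathscr{X}$, and $\{\tilde B^{\mathrm{qT}}(\tau)\}_{\tau\ge0}$ the Markov semigroup of the backwards $q$-TASEP on $\mathscr{X}$. Then for all $\mathsf t,\tau\in\mathbb{R}_{\ge0}$, $$\tilde T^{\mathrm{qT}}(\mathsf t)\,\tilde B^{\mathrm{qT}}(\tau)=\tilde B^{\mathrm{qT}}(\tau)\,\tilde T^{\mathrm{qT}}(e^{-\tau}\mathsf t),$$ i.e. $\sum_{\mathbf{y}}\tilde T^{\mathrm{qT}}(\mathsf t)(\mathbf{x},\mathbf{y})\tilde B^{\mathrm{qT}}(\tau)(\mathbf{y},\mathbf{z})=\sum_{\mathbf{y}}\tilde B^{\mathrm{qT}}(\tau)(\mathbf{x},\mathbf{y})\tilde T^{\mathrm{qT}}(e^{-\tau}\mathsf t)(\mathbf{y},\mathbf{z})$ for all $\mathbf{x},\mathbf{z}\in\mathscr{X}$. Equivalently, running the $q$-TASEP from $\mathbf{y}$ for time $\mathsf t$ and then the backwards $q$-TASEP for time $\tau$ gives the same distribution as the $q$-TASEP at time $e^{-\tau}\mathsf t$ started from the random configuration obtained by running the backwards $q$-TASEP from $\mathbf{y}$ for time $\tau$.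
   Context: $\mathscr{X}$ is the set of integer sequences $\mathbf{x}=(x_1>x_2>\dots)$ with $x_n=-n$ for all sufficiently large $n$; convention $x_0=+\infty$. $(a;q)_k=\prod_{i=0}^{k-1}(1-aq^i)$. Homogeneous continuous-time $q$-TASEP: each particle $x_n$ has an independent exponential clock of rate $1-q^{x_{n-1}-x_n-1}$ (rate $1$ for $n=1$); when it rings, $x_n$ jumps right by $1$. Backwards $q$-TASEP: each particle $x_n$, $n\ge1$, has an independent exponential clock of rate $n\,g_n$ with $g_n=x_n-x_{n+1}-1$; when it rings, $x_n$ jumps to a new location $x_n'$ with $x_{n+1}<x_n'<x_n$ chosen with probability $\frac{1}{g_n(1-q^{x_n-x_n'})}\frac{(q;q)_{g_n}}{(q;q)_{g_n'}}$, where $g_n'=x_n'-x_{n+1}-1$. *)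

theory Defs
  imports "HOL-Analysis.Analysis"
begin

definition qpoch_q :: "real \<Rightarrow> nat \<Rightarrow> real" where
  "qpoch_q q k = (\<Prod>i<k. 1 - q * q ^ i)"

text \<open>A configuration is a function x :: nat => int, read at indices n >= 1.
  The unused value x 0 (which stands for +infinity in the paper) is normalised to 0
  so that configurations are represented uniquely.\<close>
definition XX :: "(nat \<Rightarrow> int) set" where
  "XX = {x. x 0 = 0 \<and> (\<forall>n\<ge>1. x (Suc n) < x n) \<and> (\<exists>N. \<forall>n\<ge>N. x n = - int n)}"

text \<open>Q x y (for y different from x) is the jump rate from x to y on the countable state
  set S. The transition function is built by the standard Feller/Kendall minimal
  construction: P_n is the contribution of paths with exactly n jumps.\<close>

definition exit_rate :: "'a set \<Rightarrow> ('a \<Rightarrow> 'a \<Rightarrow> real) \<Rightarrow> 'a \<Rightarrow> real" where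
  "exit_rate S Q x = (\<Sum>\<^sub>\<infinity> y\<in>S - {x}. Q x y)"

primrec trans_n :: "'a set \<Rightarrow> ('a \<Rightarrow> 'a \<Rightarrow> real) \<Rightarrow> nat \<Rightarrow> real \<Rightarrow> 'a \<Rightarrow> 'a \<Rightarrow> ennreal" where
  "trans_n S Q 0 t x y = (if x = y then ennreal (exp (- exit_rate S Q x * t)) else 0)"
| "trans_n S Q (Suc n) t x y =
     (\<integral>\<^sup>+ s\<in>{0..t}. ennreal (exp (- exit_rate S Q x * s)) *
        (\<Sum>\<^sub>\<infinity> z\<in>S - {x}. ennreal (Q x z) * trans_n S Q n (t - s) z y) \<partial>lborel)"

definition markov_sg :: "'a set \<Rightarrow> ('a \<Rightarrow> 'a \<Rightarrow> real) \<Rightarrow> real \<Rightarrow> 'a \<Rightarrow> 'a \<Rightarrow> ennreal" where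
  "markov_sg S Q t x y = (\<Sum>n. trans_n S Q n t x y)"

definition qtasep_rate :: "real \<Rightarrow> (nat \<Rightarrow> int) \<Rightarrow> nat \<Rightarrow> real" where
  "qtasep_rate q x n = (if n = 1 then 1 else 1 - q ^ nat (x (n - 1) - x n - 1))"

definition qtasep_Q :: "real \<Rightarrow> (nat \<Rightarrow> int) \<Rightarrow> (nat \<Rightarrow> int) \<Rightarrow> real" where
  "qtasep_Q q x y = (\<Sum>\<^sub>\<infinity> n\<in>{1..}. if y = x(n := x n + 1) then qtasep_rate q x n else 0)"

definition qtasep_sg :: "real \<Rightarrow> real \<Rightarrow> (nat \<Rightarrow> int) \<Rightarrow> (nat \<Rightarrow> int) \<Rightarrow> ennreal" where
  "qtasep_sg q t = markov_sg XX (qtasep_Q q) t"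

text \<open>Particle n (clock rate n g_n) jumps to m, x_{n+1} < m < x_n, with probability
  1/(g_n (1 - q^(x_n - m))) * (q;q)_{g_n} / (q;q)_{g'_n}.\<close>
definition back_rate :: "real \<Rightarrow> (nat \<Rightarrow> int) \<Rightarrow> nat \<Rightarrow> int \<Rightarrow> real" where
  "back_rate q x n m =
     (let g = nat (x n - x (Suc n) - 1); g' = nat (m - x (Suc n) - 1) in
      real n * real g * (1 / (real g * (1 - q ^ nat (x n - m))) * (qpoch_q q g / qpoch_q q g')))"

definition back_Q :: "real \<Rightarrow> (nat \<Rightarrow> int) \<Rightarrow> (nat \<Rightarrow> int) \<Rightarrow> real" where
  "back_Q q x y = (\<Sum>\<^sub>\<infinity> (n, m)\<in>{(n, m). 1 \<le> n \<and> x (Suc n) < m \<and> m < x n}.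
                     if y = x(n := m) then back_rate q x n m else 0)"

definition back_sg :: "real \<Rightarrow> real \<Rightarrow> (nat \<Rightarrow> int) \<Rightarrow> (nat \<Rightarrow> int) \<Rightarrow> ennreal" where
  "back_sg q \<tau> = markov_sg XX (back_Q q) \<tau>"

end

theory Submission
  imports Defs
begin

text \<open>Let A and B be the generators of the q-TASEP and of the backwards q-TASEP. A direct
  computation with the jump rates gives \<open>[B, A] = A\<close>. Since B lowers the size \<open>\<Sum>n. x n + n\<close> of a
  configuration, its semigroup is triangular with finite rows and the commutation relation integrates
  to \<open>A e\<^bsup>\<tau>B\<^esup> = e\<^bsup>-\<tau>\<^esup> e\<^bsup>\<tau>B\<^esup> A\<close>. Hence \<open>v t = e\<^bsup>\<tau>B\<^esup> e\<^bsup>(exp (-\<tau>) t) A\<^esup>\<close> solves Kolmogorov's backward equation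
  \<open>v' = A v\<close> with initial value \<open>e\<^bsup>\<tau>B\<^esup>\<close>. The series \<open>e\<^bsup>tA\<^esup> e\<^bsup>\<tau>B\<^esup>\<close> over the number of jumps converges to
  every bounded solution of this equation, because the exit rates of A grow at most linearly in the
  number of jumps and so A does not explode.\<close>

section \<open>Preliminaries\<close>

text \<open>The relation \<open>[B, A] = A\<close> reads AB = (B - 1)A, so A passes through the
  semigroup of B at the cost of replacing B by B - 1: this is the origin of the factor exp(-tau).
  The 1 itself comes from the total exit rate of B, the sum of n g_n. By summation by parts it
  equals the size, which every q-TASEP jump raises by 1. The two sides differ in difficulty. From a
  given configuration the backwards process reaches finitely many others, so the sum on the right is
  finite. The q-TASEP reaches infinitely many, so the sum on the left cannot simply be
  differentiated term by term. It is regrouped by the number of jumps, and each group is finite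
  because only finitely many particles can move. Single matrix entries are finite sums for both
  processes, since the change of size bounds the number of jumps. What remains are finite systems of
  linear equations, for which one sign-preservation lemma yields positivity, comparison and
  uniqueness.\<close>

lemma linear_ode_nonneg:
  fixes G G' :: "real \<Rightarrow> real"
  assumes der: "\<And>s. 0 \<le> s \<Longrightarrow> (G has_real_derivative G' s) (at s within {0..})"
    and ge: "\<And>s. 0 \<le> s \<Longrightarrow> 0 \<le> G' s + a * G s"
    and "0 \<le> G 0" and "0 \<le> t"
  shows "0 \<le> G t"
proof (cases "t = 0")
  case False
  with \<open>0 \<le> t\<close> have "0 < t" by simp
  \<comment> \<open>Integrating factor: \<open>exp (a * s) * G s\<close> has nonnegative derivative,
    so the mean value theorem compares its values at 0 and t.\<close>
  have d: "((\<lambda>s. exp (a * s) * G s) has_derivative (*) (exp (a * s) * (G' s + a * G s)))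
      (at s within {0..t})" if "0 \<le> s" for s
  proof -
    have "(G has_real_derivative G' s) (at s within {0..t})"
      using der[OF that] by (rule has_field_derivative_subset) auto
    then have "((\<lambda>s. exp (a * s) * G s) has_real_derivative exp (a * s) * (G' s + a * G s))
        (at s within {0..t})"
      by (auto intro!: derivative_eq_intros simp: algebra_simps)
    then show ?thesis by (simp add: has_field_derivative_def)
  qed
  obtain s where "s \<in> {0<..<t}"
    and s: "exp (a * t) * G t - exp (a * 0) * G 0 = exp (a * s) * (G' s + a * G s) * (t - 0)"
    using mvt_simple[OF \<open>0 < t\<close> d] by blast
  then have "0 \<le> exp (a * s) * (G' s + a * G s) * (t - 0)"
    using ge[of s] \<open>0 < t\<close> by auto
  with s \<open>0 \<le> G 0\<close> have "0 \<le> exp (a * t) * G t" by simp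
  then show ?thesis by (simp add: zero_le_mult_iff)
qed (use assms in auto)

lemma infsum_ennreal_eq_sum:
  fixes f :: "'a \<Rightarrow> ennreal"
  assumes "finite F" "F \<subseteq> A" "\<And>x. x \<in> A - F \<Longrightarrow> f x = 0"
  shows "infsum f A = sum f F"
proof -
  have "infsum f A = infsum f F"
    by (rule infsum_cong_neutral) (use assms in auto)
  then show ?thesis using assms(1) by simp
qed

text \<open>Tonelli for counting measures: both sides are iterated suprema of finite partial sums,
  and suprema commute.\<close>

lemma infsum_suminf_ennreal:
  fixes f :: "nat \<Rightarrow> 'a \<Rightarrow> ennreal"
  shows "(\<Sum>\<^sub>\<infinity>y\<in>A. \<Sum>n. f n y) = (\<Sum>n. \<Sum>\<^sub>\<infinity>y\<in>A. f n y)"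
proof -
  let ?I = "{F. finite F \<and> F \<subseteq> A}"
  have fin: "(\<Sum>k<n. \<Sum>\<^sub>\<infinity>y\<in>A. f k y) = (\<Sum>\<^sub>\<infinity>y\<in>A. \<Sum>k<n. f k y)" for n
  proof (induction n)
    case (Suc n)
    have "(\<Sum>\<^sub>\<infinity>y\<in>A. (\<Sum>k<n. f k y) + f n y) = (\<Sum>\<^sub>\<infinity>y\<in>A. \<Sum>k<n. f k y) + infsum (f n) A"
      by (rule infsum_add) (auto intro: nonneg_summable_on_complete)
    with Suc show ?case by simp
  qed simp
  have "(\<Sum>\<^sub>\<infinity>y\<in>A. \<Sum>n. f n y) = (SUP F\<in>?I. \<Sum>y\<in>F. \<Sum>n. f n y)"
    by (rule nonneg_infsum_complete) simp
  also have "\<dots> = (SUP F\<in>?I. SUP n. \<Sum>y\<in>F. \<Sum>k<n. f k y)"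
  proof (rule SUP_cong[OF refl])
    fix F
    have "(\<Sum>y\<in>F. \<Sum>n. f n y) = (\<Sum>n. \<Sum>y\<in>F. f n y)"
      by (rule suminf_sum[symmetric]) simp
    also have "\<dots> = (SUP n. \<Sum>k<n. \<Sum>y\<in>F. f k y)"
      by (rule suminf_eq_SUP)
    also have "\<dots> = (SUP n. \<Sum>y\<in>F. \<Sum>k<n. f k y)"
      by (subst sum.swap) simp
    finally show "(\<Sum>y\<in>F. \<Sum>n. f n y) = (SUP n. \<Sum>y\<in>F. \<Sum>k<n. f k y)" .
  qed
  also have "\<dots> = (SUP n. SUP F\<in>?I. \<Sum>y\<in>F. \<Sum>k<n. f k y)"
    by (rule SUP_commute)
  also have "\<dots> = (SUP n. \<Sum>\<^sub>\<infinity>y\<in>A. \<Sum>k<n. f k y)"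
    by (subst nonneg_infsum_complete) simp_all
  also have "\<dots> = (\<Sum>n. \<Sum>\<^sub>\<infinity>y\<in>A. f n y)"
    by (subst suminf_eq_SUP) (simp add: fin)
  finally show ?thesis .
qed

section \<open>Row-finite graded jump rates\<close>

text \<open>Strict decrease of \<open>lev\<close> bounds the number of jumps between two given
  states by their level difference. As \<open>lev\<close> may be unbounded below, infinitely many
  states can still be reachable.\<close>

locale graded_rates =
  fixes S :: "'a set" and Q :: "'a \<Rightarrow> 'a \<Rightarrow> real" and lev :: "'a \<Rightarrow> int"
  assumes Q_nonneg: "x \<in> S \<Longrightarrow> y \<in> S \<Longrightarrow> 0 \<le> Q x y"
    and finite_Q: "x \<in> S \<Longrightarrow> finite {y \<in> S - {x}. Q x y \<noteq> 0}"
    and lev_decreasing: "x \<in> S \<Longrightarrow> y \<in> S - {x} \<Longrightarrow> Q x y \<noteq> 0 \<Longrightarrow> lev y < lev x"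
begin

section \<open>The generator and the transition probabilities split by the number of jumps\<close>

definition nbh :: "'a \<Rightarrow> 'a set" where
  "nbh x = {y \<in> S - {x}. Q x y \<noteq> 0}"

abbreviation rate :: "'a \<Rightarrow> real" where
  "rate \<equiv> exit_rate S Q"

definition gen :: "('a \<Rightarrow> real) \<Rightarrow> 'a \<Rightarrow> real" where
  "gen f x = (\<Sum>y\<in>nbh x. Q x y * (f y - f x))"

lemma finite_nbh [simp]: "x \<in> S \<Longrightarrow> finite (nbh x)"
  unfolding nbh_def by (rule finite_Q)

lemma nbh_subset: "nbh x \<subseteq> S - {x}"
  by (auto simp: nbh_def)

lemma nbhD: "y \<in> nbh x \<Longrightarrow> x \<in> S \<Longrightarrow> y \<in> S \<and> 0 \<le> Q x y \<and> lev y < lev x"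
  by (auto simp: nbh_def Q_nonneg lev_decreasing)

lemma rate_eq: "x \<in> S \<Longrightarrow> rate x = (\<Sum>y\<in>nbh x. Q x y)"
proof -
  assume "x \<in> S"
  have "rate x = infsum (Q x) (nbh x)"
    unfolding exit_rate_def by (rule infsum_cong_neutral) (auto simp: nbh_def)
  with \<open>x \<in> S\<close> show ?thesis by simp
qed

lemma gen_eq: "x \<in> S \<Longrightarrow> gen f x = - rate x * f x + (\<Sum>y\<in>nbh x. Q x y * f y)"
  by (simp add: gen_def rate_eq algebra_simps sum_subtractf sum_distrib_left sum_distrib_right)

text \<open>The recursion of \<open>trans_n\<close> with s replaced by t - s, so that s is the time
  left after the first jump. Now t enters only through a prefactor and the upper limit, and the
  fundamental theorem of calculus applies.\<close>

primrec jump_prob :: "nat \<Rightarrow> real \<Rightarrow> 'a \<Rightarrow> 'a \<Rightarrow> real" where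
  "jump_prob 0 t x y = (if x = y then exp (- rate x * t) else 0)"
| "jump_prob (Suc n) t x y = exp (- rate x * t) *
     integral {0..t} (\<lambda>s. exp (rate x * s) * (\<Sum>z\<in>nbh x. Q x z * jump_prob n s z y))"

lemma jump_prob_0: "jump_prob n 0 x y = (if n = 0 \<and> x = y then 1 else 0)"
  by (cases n) auto

text \<open>Continuity of the n-jump terms makes the integral for n + 1 jumps differentiable, hence
  continuous; the two claims therefore share one induction.\<close>

lemma
  assumes "x \<in> S"
  shows continuous_on_jump_prob: "continuous_on {0..} (\<lambda>t. jump_prob n t x y)"
    and jump_prob_Suc_deriv: "0 \<le> t \<Longrightarrow> ((\<lambda>t. jump_prob (Suc n) t x y) has_real_derivative
        - rate x * jump_prob (Suc n) t x y + (\<Sum>z\<in>nbh x. Q x z * jump_prob n t z y))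
        (at t within {0..})"
proof -
  have step: "((\<lambda>t. jump_prob (Suc n) t x y) has_real_derivative
        - rate x * jump_prob (Suc n) t x y + (\<Sum>z\<in>nbh x. Q x z * jump_prob n t z y))
        (at t within {0..})"
    if cont: "\<And>z. z \<in> S \<Longrightarrow> continuous_on {0..} (\<lambda>t. jump_prob n t z y)"
      and x: "x \<in> S" and "0 \<le> t" for n x t
  proof -
    define h where "h s = exp (rate x * s) * (\<Sum>z\<in>nbh x. Q x z * jump_prob n s z y)" for s
    have "continuous_on {0..} h"
      unfolding h_def using nbhD[OF _ x] by (intro continuous_intros cont) auto
    \<comment> \<open>The fundamental theorem is applied on a compact interval; the extra 1 makes it
      a neighbourhood of t within the half-line.\<close>
    then have "continuous_on {0..t + 1} h" by (rule continuous_on_subset) auto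
    then have "((\<lambda>u. integral {0..u} h) has_real_derivative h t) (at t within {0..t + 1})"
      using \<open>0 \<le> t\<close> by (intro integral_has_real_derivative) auto
    moreover have "at t within {0..t + 1} = at t within {0..}"
      by (rule at_within_nhd[where S = "{..<t + 1}"]) auto
    ultimately have "((\<lambda>u. integral {0..u} h) has_real_derivative h t) (at t within {0..})"
      by simp
    then have "((\<lambda>u. exp (- rate x * u) * integral {0..u} h) has_real_derivative
        - rate x * (exp (- rate x * t) * integral {0..t} h) + exp (- rate x * t) * h t)
        (at t within {0..})"
      by (auto intro!: derivative_eq_intros simp: algebra_simps)
    moreover have "exp (- rate x * t) * h t = (\<Sum>z\<in>nbh x. Q x z * jump_prob n t z y)"
      by (simp add: h_def exp_minus mult.assoc[symmetric])
    ultimately show ?thesis by (simp only: h_def[abs_def] jump_prob.simps)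
  qed
  have cont: "continuous_on {0..} (\<lambda>t. jump_prob n t x y)" if "x \<in> S" for n x
    using that
  proof (induction n arbitrary: x)
    case 0
    then show ?case by (cases "x = y") (auto intro!: continuous_intros)
  next
    case (Suc n)
    show ?case
      unfolding continuous_on_eq_continuous_within
      using step[OF Suc.IH Suc.prems] by (blast intro: DERIV_continuous)
  qed
  show "continuous_on {0..} (\<lambda>t. jump_prob n t x y)" by (rule cont) fact
  show "0 \<le> t \<Longrightarrow> ((\<lambda>t. jump_prob (Suc n) t x y) has_real_derivative
        - rate x * jump_prob (Suc n) t x y + (\<Sum>z\<in>nbh x. Q x z * jump_prob n t z y))
        (at t within {0..})"
    by (rule step[OF cont \<open>x \<in> S\<close>])
qed

lemma jump_prob_0_deriv:
  "((\<lambda>t. jump_prob 0 t x y) has_real_derivative - rate x * jump_prob 0 t x y) (at t within A)"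
  by (cases "x = y") (auto intro!: derivative_eq_intros)

lemma jump_prob_nonneg:
  assumes "x \<in> S" "0 \<le> t"
  shows "0 \<le> jump_prob n t x y"
  using assms
proof (induction n arbitrary: x t)
  case (Suc n)
  show ?case
  proof (rule linear_ode_nonneg[OF jump_prob_Suc_deriv[OF Suc.prems(1)]])
    fix s :: real assume "0 \<le> s"
    then show "0 \<le> - rate x * jump_prob (Suc n) s x y +
        (\<Sum>z\<in>nbh x. Q x z * jump_prob n s z y) + rate x * jump_prob (Suc n) s x y"
      by (auto intro!: sum_nonneg mult_nonneg_nonneg Suc.IH dest: nbhD[OF _ Suc.prems(1)]
          simp del: jump_prob.simps)
  qed (use Suc.prems in auto)
qed simp

lemma trans_n_eq:
  assumes "x \<in> S" "0 \<le> t"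
  shows "trans_n S Q n t x y = ennreal (jump_prob n t x y)"
  using assms
proof (induction n arbitrary: x t)
  case (Suc n)
  define h where "h s = (\<Sum>z\<in>nbh x. Q x z * jump_prob n s z y)" for s
  define k where "k s = exp (rate x * s) * h s" for s
  have h_nonneg: "0 \<le> h s" if "0 \<le> s" for s
    unfolding h_def using that nbhD[OF _ Suc.prems(1)]
    by (intro sum_nonneg mult_nonneg_nonneg jump_prob_nonneg) auto
  have inner: "(\<Sum>\<^sub>\<infinity> z\<in>S - {x}. ennreal (Q x z) * trans_n S Q n s z y) = ennreal (h s)"
    if "0 \<le> s" for s
  proof -
    have "(\<Sum>\<^sub>\<infinity> z\<in>S - {x}. ennreal (Q x z) * trans_n S Q n s z y)
        = (\<Sum>z\<in>nbh x. ennreal (Q x z) * trans_n S Q n s z y)"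
      using Suc.prems(1) finite_nbh[of x] nbh_subset[of x]
      by (intro infsum_ennreal_eq_sum) (auto simp: nbh_def[of x])
    also have "\<dots> = (\<Sum>z\<in>nbh x. ennreal (Q x z * jump_prob n s z y))"
      using nbhD[OF _ Suc.prems(1)] that
      by (intro sum.cong) (auto simp: Suc.IH ennreal_mult jump_prob_nonneg)
    also have "\<dots> = ennreal (h s)"
      unfolding h_def using nbhD[OF _ Suc.prems(1)] that
      by (intro sum_ennreal mult_nonneg_nonneg jump_prob_nonneg) auto
    finally show ?thesis .
  qed
  have "continuous_on {0..} k"
    unfolding k_def h_def using nbhD[OF _ Suc.prems(1)]
    by (intro continuous_intros continuous_on_jump_prob) auto
  then have "k integrable_on {0..t}"
    by (intro integrable_continuous_real) (auto elim: continuous_on_subset)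
  then have "(k has_integral integral {0..t} k) {0..t}" by blast
  \<comment> \<open>Reflection and then translation carry out the substitution of t - s for s that
    separates \<open>jump_prob\<close> from \<open>trans_n\<close>.\<close>
  then have "((\<lambda>s. k (- s)) has_integral integral {0..t} k) {-t..0}"
    using has_integral_reflect_real[of k "integral {0..t} k" t 0] by simp
  then have "((\<lambda>s. k (- (1 * s + - t))) has_integral integral {0..t} k) {0..t}"
    using has_integral_affinity'[of "\<lambda>s. k (- s)" "integral {0..t} k" "-t" 0 1 "-t"] by simp
  then have "((\<lambda>s. exp (- rate x * t) * k (t - s)) has_integral
      exp (- rate x * t) * integral {0..t} k) {0..t}"
    by (intro has_integral_mult_right) simp
  moreover have "exp (- rate x * t) * k (t - s) = exp (- rate x * s) * h (t - s)" for s
    by (simp add: k_def mult.assoc[symmetric] exp_add[symmetric] algebra_simps)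
  ultimately have "((\<lambda>s. exp (- rate x * s) * h (t - s)) has_integral jump_prob (Suc n) t x y) {0..t}"
    by (simp only: k_def[abs_def] h_def jump_prob.simps)
  then have "(\<integral>\<^sup>+ s. ennreal (exp (- rate x * s) * h (t - s)) * indicator {0..t} s \<partial>lborel)
      = ennreal (jump_prob (Suc n) t x y)"
    by (intro nn_integral_has_integral_lebesgue') (auto simp: h_nonneg)
  moreover have "trans_n S Q (Suc n) t x y =
      (\<integral>\<^sup>+ s. ennreal (exp (- rate x * s) * h (t - s)) * indicator {0..t} s \<partial>lborel)"
    unfolding trans_n.simps
    by (intro nn_integral_cong) (auto simp: inner h_nonneg ennreal_mult split: split_indicator)
  ultimately show ?case by simp
qed simp

section \<open>States reached by exactly n jumps, and finite sums over n\<close>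

primrec reach :: "nat \<Rightarrow> 'a \<Rightarrow> 'a set" where
  "reach 0 x = {x}"
| "reach (Suc n) x = (\<Union>z\<in>nbh x. reach n z)"

text \<open>Finiteness holds for each fixed n, although the union over n may be infinite; the n-jump
  terms thus have finite support.\<close>

lemma finite_reach [simp]: "x \<in> S \<Longrightarrow> finite (reach n x)"
  by (induction n arbitrary: x) (auto dest: nbhD)

lemma reach_subset: "x \<in> S \<Longrightarrow> reach n x \<subseteq> S"
proof (induction n arbitrary: x)
  case (Suc n)
  then show ?case using nbhD[OF _ Suc.prems] by fastforce
qed simp

lemma lev_reach: "x \<in> S \<Longrightarrow> y \<in> reach n x \<Longrightarrow> lev y + int n \<le> lev x"
proof (induction n arbitrary: x)
  case (Suc n)
  then obtain z where z: "z \<in> nbh x" "y \<in> reach n z" by auto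
  show ?case using Suc.IH[OF _ z(2)] nbhD[OF z(1) Suc.prems(1)] by simp
qed simp

lemma jump_prob_outside_reach: "y \<notin> reach n x \<Longrightarrow> jump_prob n t x y = 0"
  by (induction n arbitrary: x t) auto

text \<open>Consequently the series over n for a single entry terminates.\<close>

lemma jump_prob_lev: "x \<in> S \<Longrightarrow> lev x - lev y < int n \<Longrightarrow> jump_prob n t x y = 0"
  using lev_reach[of x y n] by (auto intro: jump_prob_outside_reach)

text \<open>Kolmogorov's backward equation for paths with at most n jumps: the first jump uses up
  one of them, so the neighbours carry one term fewer.\<close>

lemma sum_jump_prob_deriv:
  assumes "x \<in> S" "0 \<le> t"
  shows "((\<lambda>t. \<Sum>k<Suc n. jump_prob k t x y) has_real_derivative
    - rate x * (\<Sum>k<Suc n. jump_prob k t x y)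
    + (\<Sum>z\<in>nbh x. Q x z * (\<Sum>k<n. jump_prob k t z y))) (at t within {0..})"
proof (induction n)
  case 0
  then show ?case using jump_prob_0_deriv[of x y t] by (simp del: jump_prob.simps)
next
  case (Suc n)
  have "((\<lambda>t. (\<Sum>k<Suc n. jump_prob k t x y) + jump_prob (Suc n) t x y) has_real_derivative
    - rate x * (\<Sum>k<Suc n. jump_prob k t x y) + (\<Sum>z\<in>nbh x. Q x z * (\<Sum>k<n. jump_prob k t z y))
    + (- rate x * jump_prob (Suc n) t x y + (\<Sum>z\<in>nbh x. Q x z * jump_prob n t z y)))
    (at t within {0..})"
    by (rule DERIV_add[OF Suc jump_prob_Suc_deriv[OF assms]])
  then show ?case
    by (simp add: algebra_simps sum.distrib del: jump_prob.simps)
qed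

text \<open>The missing mass G satisfies G' + rate G = rate - H, where H is the contribution of the
  neighbours; by induction H is at most the exit rate.\<close>

lemma sum_jump_prob_le_1:
  assumes "x \<in> S" "0 \<le> t" "finite F"
  shows "(\<Sum>y\<in>F. \<Sum>k<n. jump_prob k t x y) \<le> 1"
  using assms(1,2)
proof (induction n arbitrary: x t)
  case (Suc n)
  define G where "G t = 1 - (\<Sum>y\<in>F. \<Sum>k<Suc n. jump_prob k t x y)" for t
  define H where "H t = (\<Sum>z\<in>nbh x. Q x z * (\<Sum>y\<in>F. \<Sum>k<n. jump_prob k t z y))" for t
  have "0 \<le> G t"
  proof (rule linear_ode_nonneg[where G = G])
    fix s :: real assume "0 \<le> s"
    have "((\<lambda>t. \<Sum>y\<in>F. \<Sum>k<Suc n. jump_prob k t x y) has_real_derivative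
      (\<Sum>y\<in>F. - rate x * (\<Sum>k<Suc n. jump_prob k s x y)
      + (\<Sum>z\<in>nbh x. Q x z * (\<Sum>k<n. jump_prob k s z y)))) (at s within {0..})"
      using Suc.prems(1) \<open>0 \<le> s\<close> by (intro DERIV_sum sum_jump_prob_deriv)
    moreover have "(\<Sum>y\<in>F. \<Sum>z\<in>nbh x. Q x z * (\<Sum>k<n. jump_prob k s z y)) = H s"
      unfolding H_def by (subst sum.swap) (simp add: sum_distrib_left)
    ultimately have "((\<lambda>t. \<Sum>y\<in>F. \<Sum>k<Suc n. jump_prob k t x y) has_real_derivative
      - rate x * (1 - G s) + H s) (at s within {0..})"
      by (simp only: G_def sum.distrib sum_distrib_left[symmetric]) simp
    then show "(G has_real_derivative rate x * (1 - G s) - H s) (at s within {0..})"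
      unfolding G_def[abs_def] by (rule DERIV_cong[OF DERIV_diff[OF DERIV_const]]) simp
    have "H s \<le> (\<Sum>z\<in>nbh x. Q x z * 1)"
      unfolding H_def using nbhD[OF _ Suc.prems(1)] \<open>0 \<le> s\<close>
      by (intro sum_mono mult_left_mono Suc.IH) auto
    then have "H s \<le> rate x" using Suc.prems(1) by (simp add: rate_eq)
    then show "0 \<le> rate x * (1 - G s) - H s + rate x * G s"
      by (simp add: algebra_simps)
  next
    have "(\<Sum>y\<in>F. \<Sum>k<Suc n. jump_prob k 0 x y) = (\<Sum>y\<in>F. if y = x then 1 else 0)"
      by (intro sum.cong refl)
        (auto simp: jump_prob_0 lessThan_Suc_eq_insert_0 sum.insert_if sum.reindex simp del: jump_prob.simps)
    also have "\<dots> \<le> 1" using assms(3) by simp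
    finally show "0 \<le> G 0" by (simp add: G_def)
  qed fact
  then show ?case by (simp add: G_def)
qed simp

text \<open>The terms beyond the cutoff vanish by \<open>jump_prob_lev\<close>. If y has a higher
  level than x, \<open>nat\<close> gives 0 and the remaining term n = 0 vanishes too.\<close>

definition prob :: "real \<Rightarrow> 'a \<Rightarrow> 'a \<Rightarrow> real" where
  "prob t x y = (\<Sum>n<Suc (nat (lev x - lev y)). jump_prob n t x y)"

lemma prob_eq:
  assumes "x \<in> S" "lev x - lev y < int M"
  shows "prob t x y = (\<Sum>n<M. jump_prob n t x y)"
  unfolding prob_def
  by (rule sum.mono_neutral_cong) (use assms in \<open>auto intro!: jump_prob_lev\<close>)

lemma prob_nonneg: "x \<in> S \<Longrightarrow> 0 \<le> t \<Longrightarrow> 0 \<le> prob t x y"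
  unfolding prob_def by (intro sum_nonneg jump_prob_nonneg)

lemma markov_sg_eq:
  assumes "x \<in> S" "0 \<le> t"
  shows "markov_sg S Q t x y = ennreal (prob t x y)"
proof -
  let ?M = "Suc (nat (lev x - lev y))"
  have "markov_sg S Q t x y = (\<Sum>n<?M. trans_n S Q n t x y)"
    unfolding markov_sg_def
    by (rule suminf_finite) (use assms in \<open>auto simp: trans_n_eq jump_prob_lev\<close>)
  also have "\<dots> = (\<Sum>n<?M. ennreal (jump_prob n t x y))"
    using assms by (intro sum.cong) (auto simp: trans_n_eq)
  also have "\<dots> = ennreal (prob t x y)"
    unfolding prob_def using assms by (intro sum_ennreal jump_prob_nonneg) auto
  finally show ?thesis .
qed

lemma prob_0: "x \<in> S \<Longrightarrow> prob 0 x y = (if x = y then 1 else 0)"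
  unfolding prob_def
  by (auto simp: jump_prob_0 lessThan_Suc_eq_insert_0 sum.insert_if sum.reindex simp del: jump_prob.simps)

lemma prob_deriv:
  assumes "x \<in> S" "0 \<le> t"
  shows "((\<lambda>t. prob t x y) has_real_derivative gen (\<lambda>x. prob t x y) x) (at t within {0..})"
proof -
  \<comment> \<open>Cutoffs \<open>Suc M\<close> at x and \<open>M\<close> at the neighbours match
    the off-by-one of the truncated equation, and both exceed the relevant level
    differences.\<close>
  define M where "M = Suc (nat (lev x - lev y))"
  have x: "prob s x y = (\<Sum>n<Suc M. jump_prob n s x y)" for s
    by (rule prob_eq) (use assms in \<open>auto simp: M_def\<close>)
  have z: "prob s z y = (\<Sum>n<M. jump_prob n s z y)" if "z \<in> nbh x" for z s
    by (rule prob_eq) (use nbhD[OF that assms(1)] in \<open>auto simp: M_def\<close>)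
  show ?thesis
    unfolding gen_eq[OF assms(1)] x
    using sum_jump_prob_deriv[OF assms] z by (simp del: sum.lessThan_Suc)
qed

lemma sum_prob_le_1:
  assumes "x \<in> S" "0 \<le> t" "finite F"
  shows "(\<Sum>y\<in>F. prob t x y) \<le> 1"
proof -
  obtain M :: nat where M: "\<And>y. y \<in> F \<Longrightarrow> nat (lev x - lev y) < M"
    using assms(3) finite_nat_set_iff_bounded[of "(\<lambda>y. nat (lev x - lev y)) ` F"] by auto
  have "(\<Sum>y\<in>F. prob t x y) = (\<Sum>y\<in>F. \<Sum>n<M. jump_prob n t x y)"
    using assms(1) by (intro sum.cong prob_eq) (auto dest!: M)
  then show ?thesis using sum_jump_prob_le_1[OF assms] by simp
qed

section \<open>States reached by any number of jumps\<close>

definition reachable :: "'a \<Rightarrow> 'a set" where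
  "reachable x = (\<Union>n. reach n x)"

lemma reachable_subset: "x \<in> S \<Longrightarrow> reachable x \<subseteq> S"
  using reach_subset by (auto simp: reachable_def)

lemma reachable_nbh: "z \<in> nbh x \<Longrightarrow> reachable z \<subseteq> reachable x"
proof
  fix y assume z: "z \<in> nbh x" and "y \<in> reachable z"
  then obtain n where "y \<in> reach n z" by (auto simp: reachable_def)
  with z have "y \<in> reach (Suc n) x" by auto
  then show "y \<in> reachable x" unfolding reachable_def by blast
qed

lemma prob_outside_reachable: "y \<notin> reachable x \<Longrightarrow> prob t x y = 0"
  unfolding prob_def reachable_def by (intro sum.neutral) (auto intro: jump_prob_outside_reach)

text \<open>With levels bounded below by 0, a path from x makes at most \<open>lev x\<close>
  jumps.\<close>

lemma finite_reachable:
  assumes "x \<in> S" and lev: "\<And>y. y \<in> S \<Longrightarrow> 0 \<le> lev y"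
  shows "finite (reachable x)"
proof -
  have "reach n x \<subseteq> (\<Union>n\<le>nat (lev x). reach n x)" for n
  proof
    fix y assume y: "y \<in> reach n x"
    with assms have "int n \<le> lev x" using lev_reach[OF assms(1) y] reach_subset[of x n] by force
    with y show "y \<in> (\<Union>n\<le>nat (lev x). reach n x)" by auto
  qed
  then have "reachable x \<subseteq> (\<Union>n\<le>nat (lev x). reach n x)" by (auto simp: reachable_def)
  then show ?thesis by (rule finite_subset) (use assms in auto)
qed

text \<open>The index set may contain moves of rate zero, such as blocked jumps whose target leaves
  S; hence only indices with nonzero rate are matched with neighbours.\<close>

lemma sum_nbh_reindex:
  assumes "finite I" "inj_on h I"
    and "\<And>i. i \<in> I \<Longrightarrow> r i \<noteq> 0 \<Longrightarrow> h i \<in> S - {x} \<and> Q x (h i) = r i"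
    and "\<And>y. y \<in> S - {x} \<Longrightarrow> Q x y \<noteq> 0 \<Longrightarrow> \<exists>i\<in>I. y = h i \<and> r i \<noteq> 0"
  shows "(\<Sum>y\<in>nbh x. Q x y * F y) = (\<Sum>i\<in>I. r i * F (h i))"
proof -
  have "nbh x = h ` {i \<in> I. r i \<noteq> 0}"
    using assms(3,4) unfolding nbh_def by fastforce
  then have "(\<Sum>y\<in>nbh x. Q x y * F y) = (\<Sum>i | i \<in> I \<and> r i \<noteq> 0. Q x (h i) * F (h i))"
    using assms(2) by (simp add: sum.reindex inj_on_subset o_def)
  also have "\<dots> = (\<Sum>i | i \<in> I \<and> r i \<noteq> 0. r i * F (h i))"
    using assms(3) by (intro sum.cong) auto
  also have "\<dots> = (\<Sum>i\<in>I. r i * F (h i))"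
    using assms(1) by (intro sum.mono_neutral_left) auto
  finally show ?thesis .
qed

section \<open>The semigroup and its n-jump parts acting on functions\<close>

lemma gen_cong: "x \<in> S \<Longrightarrow> (\<And>y. y \<in> S \<Longrightarrow> f y = g y) \<Longrightarrow> gen f x = gen g x"
  unfolding gen_def using nbhD[of _ x] by (intro sum.cong) auto

lemma gen_deriv:
  assumes "x \<in> S" "\<And>y. y \<in> S \<Longrightarrow> ((\<lambda>t. f t y) has_real_derivative f' y) (at t within A)"
  shows "((\<lambda>t. gen (f t) x) has_real_derivative gen f' x) (at t within A)"
  unfolding gen_def using assms nbhD[OF _ assms(1)]
  by (intro DERIV_sum DERIV_cmult DERIV_diff) auto

text \<open>A sum over an infinite set is 0 by default, so this is the semigroup action only when
  \<open>reachable x\<close> is finite, as for the backwards process. The parts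
  \<open>jump_act\<close> have finite index sets for both processes.\<close>

definition act :: "real \<Rightarrow> ('a \<Rightarrow> real) \<Rightarrow> 'a \<Rightarrow> real" where
  "act t f x = (\<Sum>y\<in>reachable x. prob t x y * f y)"

definition jump_act :: "nat \<Rightarrow> real \<Rightarrow> ('a \<Rightarrow> real) \<Rightarrow> 'a \<Rightarrow> real" where
  "jump_act n t f x = (\<Sum>y\<in>reach n x. jump_prob n t x y * f y)"

lemma act_0:
  assumes "x \<in> S" "finite (reachable x)"
  shows "act 0 f x = f x"
proof -
  have "x \<in> reachable x" using UN_upper[of 0 UNIV "\<lambda>n. reach n x"] by (auto simp: reachable_def)
  moreover have "act 0 f x = (\<Sum>y\<in>reachable x. if x = y then f y else 0)"
    unfolding act_def using assms(1) by (intro sum.cong) (auto simp: prob_0)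
  ultimately show ?thesis using assms(2) by simp
qed

lemma act_deriv:
  assumes "x \<in> S" "0 \<le> t" "finite (reachable x)"
  shows "((\<lambda>t. act t f x) has_real_derivative gen (act t f) x) (at t within {0..})"
proof -
  \<comment> \<open>Entries vanish outside the reachable set of z, so all neighbours can share the
    index set \<open>reachable x\<close>.\<close>
  have z: "act t f z = (\<Sum>y\<in>reachable x. prob t z y * f y)" if "z \<in> nbh x" for z
    unfolding act_def using reachable_nbh[OF that] assms(3)
    by (intro sum.mono_neutral_left) (auto simp: prob_outside_reachable)
  have "((\<lambda>t. act t f x) has_real_derivative
      (\<Sum>y\<in>reachable x. gen (\<lambda>x. prob t x y) x * f y)) (at t within {0..})"
    unfolding act_def using assms by (intro DERIV_sum DERIV_cmult_right prob_deriv)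
  also have "(\<Sum>y\<in>reachable x. gen (\<lambda>x. prob t x y) x * f y)
      = (\<Sum>z\<in>nbh x. \<Sum>y\<in>reachable x. Q x z * (prob t z y - prob t x y) * f y)"
    unfolding gen_def sum_distrib_right by (rule sum.swap)
  also have "\<dots> = (\<Sum>z\<in>nbh x. Q x z * (act t f z - act t f x))"
    by (intro sum.cong refl)
      (simp add: z, simp add: act_def algebra_simps sum_subtractf sum_distrib_left)
  also have "\<dots> = gen (act t f) x" by (simp add: gen_def)
  finally show ?thesis .
qed

lemma jump_act_0_deriv:
  "((\<lambda>t. jump_act 0 t f x) has_real_derivative - rate x * jump_act 0 t f x) (at t within A)"
  unfolding jump_act_def by (auto intro!: derivative_eq_intros)

lemma jump_act_Suc_deriv:
  assumes "x \<in> S" "0 \<le> t"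
  shows "((\<lambda>t. jump_act (Suc n) t f x) has_real_derivative
    - rate x * jump_act (Suc n) t f x + (\<Sum>z\<in>nbh x. Q x z * jump_act n t f z)) (at t within {0..})"
proof -
  let ?R = "reach (Suc n) x"
  have z: "jump_act n t f z = (\<Sum>y\<in>?R. jump_prob n t z y * f y)" if "z \<in> nbh x" for z
    unfolding jump_act_def
    by (intro sum.mono_neutral_left finite_reach assms)
      (use that in \<open>auto simp: jump_prob_outside_reach\<close>)
  have "((\<lambda>t. jump_act (Suc n) t f x) has_real_derivative (\<Sum>y\<in>?R.
      (- rate x * jump_prob (Suc n) t x y + (\<Sum>z\<in>nbh x. Q x z * jump_prob n t z y)) * f y))
      (at t within {0..})"
    unfolding jump_act_def using assms by (intro DERIV_sum DERIV_cmult_right jump_prob_Suc_deriv)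
  also have "(\<Sum>y\<in>?R.
      (- rate x * jump_prob (Suc n) t x y + (\<Sum>z\<in>nbh x. Q x z * jump_prob n t z y)) * f y)
      = - rate x * jump_act (Suc n) t f x + (\<Sum>y\<in>?R. \<Sum>z\<in>nbh x. Q x z * jump_prob n t z y * f y)"
    by (simp add: jump_act_def sum.distrib sum_distrib_left sum_distrib_right algebra_simps
        sum_subtractf sum_negf del: jump_prob.simps reach.simps)
  also have "(\<Sum>y\<in>?R. \<Sum>z\<in>nbh x. Q x z * jump_prob n t z y * f y)
      = (\<Sum>z\<in>nbh x. \<Sum>y\<in>?R. Q x z * jump_prob n t z y * f y)"
    by (rule sum.swap)
  also have "\<dots> = (\<Sum>z\<in>nbh x. Q x z * jump_act n t f z)"
    by (intro sum.cong refl) (simp add: z sum_distrib_left mult.assoc del: reach.simps)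
  finally show ?thesis .
qed

lemma sum_jump_act_deriv:
  assumes "x \<in> S" "0 \<le> t"
  shows "((\<lambda>t. \<Sum>k<Suc n. jump_act k t f x) has_real_derivative
    - rate x * (\<Sum>k<Suc n. jump_act k t f x) + (\<Sum>z\<in>nbh x. Q x z * (\<Sum>k<n. jump_act k t f z)))
    (at t within {0..})"
proof (induction n)
  case 0
  then show ?case using jump_act_0_deriv[of f x t] by simp
next
  case (Suc n)
  have "((\<lambda>t. (\<Sum>k<Suc n. jump_act k t f x) + jump_act (Suc n) t f x) has_real_derivative
    - rate x * (\<Sum>k<Suc n. jump_act k t f x) + (\<Sum>z\<in>nbh x. Q x z * (\<Sum>k<n. jump_act k t f z))
    + (- rate x * jump_act (Suc n) t f x + (\<Sum>z\<in>nbh x. Q x z * jump_act n t f z)))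
    (at t within {0..})"
    by (rule DERIV_add[OF Suc jump_act_Suc_deriv[OF assms]])
  then show ?case
    by (simp add: algebra_simps sum.distrib)
qed

lemma sum_jump_act_at_0: "(\<Sum>k<Suc n. jump_act k 0 f x) = f x"
proof -
  have "jump_act (Suc k) 0 f x = 0" for k
    by (simp add: jump_act_def)
  then show ?thesis
    by (subst sum.lessThan_Suc_shift) (simp add: jump_act_def)
qed

text \<open>Interchanging the sums turns an infinite sum over states into a series over jump numbers
  whose terms are finite sums; its value is a separate question.\<close>

lemma infsum_markov_sg:
  assumes x: "x \<in> S" and t: "0 \<le> t" and f: "\<And>y. y \<in> S \<Longrightarrow> 0 \<le> f y"
  shows "(\<Sum>\<^sub>\<infinity>y\<in>S. markov_sg S Q t x y * ennreal (f y)) = (\<Sum>n. ennreal (jump_act n t f x))"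
proof -
  have "(\<Sum>\<^sub>\<infinity>y\<in>S. markov_sg S Q t x y * ennreal (f y))
      = (\<Sum>\<^sub>\<infinity>y\<in>S. \<Sum>n. ennreal (jump_prob n t x y) * ennreal (f y))"
    unfolding markov_sg_def using x t by (simp add: trans_n_eq del: jump_prob.simps)
  also have "\<dots> = (\<Sum>n. \<Sum>\<^sub>\<infinity>y\<in>S. ennreal (jump_prob n t x y) * ennreal (f y))"
    by (rule infsum_suminf_ennreal)
  also have "\<dots> = (\<Sum>n. ennreal (jump_act n t f x))"
  proof (rule suminf_cong)
    fix n
    have R: "y \<in> S" if "y \<in> reach n x" for y using reach_subset[OF x] that by blast
    have "(\<Sum>\<^sub>\<infinity>y\<in>S. ennreal (jump_prob n t x y) * ennreal (f y))
        = (\<Sum>y\<in>reach n x. ennreal (jump_prob n t x y) * ennreal (f y))"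
      using x R by (intro infsum_ennreal_eq_sum) (auto simp: jump_prob_outside_reach)
    also have "\<dots> = (\<Sum>y\<in>reach n x. ennreal (jump_prob n t x y * f y))"
      using x t R by (intro sum.cong) (auto simp: ennreal_mult jump_prob_nonneg f)
    also have "\<dots> = ennreal (jump_act n t f x)"
      unfolding jump_act_def using x t R by (intro sum_ennreal mult_nonneg_nonneg jump_prob_nonneg f) auto
    finally show "(\<Sum>\<^sub>\<infinity>y\<in>S. ennreal (jump_prob n t x y) * ennreal (f y)) = ennreal (jump_act n t f x)" .
  qed
  finally show ?thesis .
qed

lemma infsum_markov_sg_finite:
  assumes x: "x \<in> S" and t: "0 \<le> t" and f: "\<And>y. y \<in> S \<Longrightarrow> 0 \<le> f y" and fin: "finite (reachable x)"
  shows "(\<Sum>\<^sub>\<infinity>y\<in>S. markov_sg S Q t x y * ennreal (f y)) = ennreal (act t f x)"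
proof -
  have R: "y \<in> S" if "y \<in> reachable x" for y using reachable_subset[OF x] that by blast
  have "(\<Sum>\<^sub>\<infinity>y\<in>S. markov_sg S Q t x y * ennreal (f y))
      = (\<Sum>y\<in>reachable x. markov_sg S Q t x y * ennreal (f y))"
    using x t R fin by (intro infsum_ennreal_eq_sum) (auto simp: markov_sg_eq prob_outside_reachable)
  also have "\<dots> = (\<Sum>y\<in>reachable x. ennreal (prob t x y * f y))"
    using x t R by (intro sum.cong) (auto simp: ennreal_mult markov_sg_eq prob_nonneg f)
  also have "\<dots> = ennreal (act t f x)"
    unfolding act_def using x t R by (intro sum_ennreal mult_nonneg_nonneg prob_nonneg f) auto
  finally show ?thesis .
qed

end

section \<open>Intertwining of two semigroups\<close>

text \<open>Only \<open>levB\<close> is bounded below. The jumps of QA may reach infinitely many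
  states, and \<phi> supplies the control of their number that \<open>levA\<close> cannot
  give.\<close>

locale intertwined_rates =
  A: graded_rates S QA levA + B: graded_rates S QB levB
  for S :: "'a set" and QA QB levA levB +
  fixes \<phi> :: "'a \<Rightarrow> real"
  assumes levB_nonneg: "x \<in> S \<Longrightarrow> 0 \<le> levB x"
    and \<phi>_pos: "x \<in> S \<Longrightarrow> 0 < \<phi> x"
    and rate_le_\<phi>: "x \<in> S \<Longrightarrow> exit_rate S QA x \<le> \<phi> x"
    and \<phi>_jump: "x \<in> S \<Longrightarrow> y \<in> S - {x} \<Longrightarrow> QA x y \<noteq> 0 \<Longrightarrow> \<phi> y = \<phi> x + 1"
    and commutator: "x \<in> S \<Longrightarrow> B.gen (A.gen f) x - A.gen (B.gen f) x = A.gen f x"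
begin

lemma finite_B_reachable [simp]: "x \<in> S \<Longrightarrow> finite (B.reachable x)"
  by (rule B.finite_reachable) (auto intro: levB_nonneg)

text \<open>The defect \<open>M \<tau> = A e\<^bsup>\<tau>B\<^esup> - e\<^bsup>-\<tau>\<^esup> e\<^bsup>\<tau>B\<^esup> A\<close> satisfies \<open>M' = (B - 1) M\<close> and \<open>M 0 = 0\<close>;
  as B only lowers the level, this system is triangular.\<close>

lemma gen_act_intertwining:
  assumes "x \<in> S" "0 \<le> \<tau>"
  shows "A.gen (B.act \<tau> f) x = exp (- \<tau>) * B.act \<tau> (A.gen f) x"
  using assms
proof (induction "nat (levB x)" arbitrary: x \<tau> rule: less_induct)
  case less
  note x = \<open>x \<in> S\<close>
  define M where "M s = A.gen (B.act s f) x - exp (- s) * B.act s (A.gen f) x" for s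
  have IH: "A.gen (B.act s f) y = exp (- s) * B.act s (A.gen f) y" if "y \<in> B.nbh x" "0 \<le> s" for y s
    using B.nbhD[OF that(1) x] levB_nonneg[OF x] levB_nonneg[of y] that(2) by (intro less.hyps) auto
  have M0: "M 0 = 0"
    unfolding M_def using x by (simp add: B.act_0 A.gen_cong[of x "B.act 0 f" f])
  \<comment> \<open>The commutator turns A(Bg) into B(Ag) - Ag, whence the extra 1 in the
    coefficient. By induction the neighbour contributions cancel, which leaves a scalar homogeneous
    equation.\<close>
  have M': "(M has_real_derivative - (B.rate x + 1) * M s) (at s within {0..})" if s: "0 \<le> s" for s
  proof -
    let ?g = "B.act s f" and ?h = "B.act s (A.gen f)"
    have "(M has_real_derivative A.gen (B.gen ?g) x
        - (exp (- s) * B.gen ?h x - exp (- s) * ?h x)) (at s within {0..})"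
      unfolding M_def[abs_def] using x s
      by (auto intro!: derivative_eq_intros A.gen_deriv B.act_deriv simp: algebra_simps)
    moreover have "(\<Sum>y\<in>B.nbh x. QB x y * A.gen ?g y) = exp (- s) * (\<Sum>y\<in>B.nbh x. QB x y * ?h y)"
      by (simp add: IH s sum_distrib_left algebra_simps)
    then have "A.gen (B.gen ?g) x - (exp (- s) * B.gen ?h x - exp (- s) * ?h x)
        = - (B.rate x + 1) * M s"
      using commutator[OF x, of ?g] by (simp add: B.gen_eq x M_def algebra_simps)
    ultimately show ?thesis by simp
  qed
  \<comment> \<open>Uniqueness: a solution that starts at 0 stays nonnegative, and so does its
    negative.\<close>
  have "0 \<le> M \<tau>"
    by (rule linear_ode_nonneg[OF M', where a = "B.rate x + 1"])
      (use M0 less.prems in \<open>auto simp: algebra_simps\<close>)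
  moreover have "0 \<le> - M \<tau>"
    by (rule linear_ode_nonneg[where G = "\<lambda>s. - M s", OF DERIV_minus[OF M'], where a = "B.rate x + 1"])
      (use M0 less.prems in \<open>auto simp: algebra_simps\<close>)
  ultimately show ?case by (simp add: M_def)
qed

section \<open>The jump expansion of the left-hand side and its limit\<close>

context
  fixes \<tau> :: real and z :: 'a
  assumes \<tau>: "0 \<le> \<tau>" and z: "z \<in> S"
begin

text \<open>The right-hand side of the intertwining relation for fixed z, as a function of t and the
  starting state; the jump expansion of the left-hand side converges to it.\<close>

definition limit_act :: "real \<Rightarrow> 'a \<Rightarrow> real" where
  "limit_act t = B.act \<tau> (\<lambda>y. A.prob (exp (- \<tau>) * t) y z)"

text \<open>The chain rule produces the factor \<open>exp (- \<tau>)\<close>, exactly the one that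
  \<open>gen_act_intertwining\<close> needs to bring the generator of A in front of the semigroup of
  B.\<close>

lemma limit_act_deriv:
  assumes x: "x \<in> S" and t: "0 \<le> t"
  shows "((\<lambda>t. limit_act t x) has_real_derivative A.gen (limit_act t) x) (at t within {0..})"
proof -
  have d: "((\<lambda>t. A.prob (exp (- \<tau>) * t) y z) has_real_derivative
      A.gen (\<lambda>y. A.prob (exp (- \<tau>) * t) y z) y * exp (- \<tau>)) (at t within {0..})"
    if "y \<in> B.reachable x" for y
  proof -
    have "((\<lambda>t. A.prob t y z) has_real_derivative A.gen (\<lambda>y. A.prob (exp (- \<tau>) * t) y z) y)
        (at (exp (- \<tau>) * t) within {0..})"
      using that B.reachable_subset[OF x] t by (intro A.prob_deriv) auto
    then have "((\<lambda>t. A.prob t y z) has_real_derivative A.gen (\<lambda>y. A.prob (exp (- \<tau>) * t) y z) y)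
        (at (exp (- \<tau>) * t) within (*) (exp (- \<tau>)) ` {0..})"
      by (rule has_field_derivative_subset) auto
    from DERIV_image_chain[OF this, of "exp (- \<tau>)"] show ?thesis
      by (auto simp: o_def intro!: derivative_eq_intros)
  qed
  have "((\<lambda>t. limit_act t x) has_real_derivative (\<Sum>y\<in>B.reachable x. B.prob \<tau> x y *
      (A.gen (\<lambda>y. A.prob (exp (- \<tau>) * t) y z) y * exp (- \<tau>)))) (at t within {0..})"
    unfolding limit_act_def B.act_def by (intro DERIV_sum DERIV_cmult d)
  also have "(\<Sum>y\<in>B.reachable x. B.prob \<tau> x y *
      (A.gen (\<lambda>y. A.prob (exp (- \<tau>) * t) y z) y * exp (- \<tau>)))
      = exp (- \<tau>) * B.act \<tau> (A.gen (\<lambda>y. A.prob (exp (- \<tau>) * t) y z)) x"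
    by (simp add: B.act_def sum_distrib_left algebra_simps)
  also have "\<dots> = A.gen (limit_act t) x"
    unfolding limit_act_def using gen_act_intertwining[OF x \<tau>] by simp
  finally show ?thesis .
qed

lemma limit_act_0: "x \<in> S \<Longrightarrow> limit_act 0 x = B.prob \<tau> x z"
proof -
  assume x: "x \<in> S"
  have "limit_act 0 x = (\<Sum>y\<in>B.reachable x. if y = z then B.prob \<tau> x y else 0)"
    unfolding limit_act_def B.act_def using B.reachable_subset[OF x]
    by (intro sum.cong) (auto simp: A.prob_0)
  with x show ?thesis by (simp add: B.prob_outside_reachable)
qed

text \<open>The bound 1 starts the remainder estimate at n = 0.\<close>

lemma limit_act_bounds:
  assumes x: "x \<in> S" and t: "0 \<le> t"
  shows "0 \<le> limit_act t x" "limit_act t x \<le> 1"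
proof -
  have S: "y \<in> S" if "y \<in> B.reachable x" for y using B.reachable_subset[OF x] that by blast
  show "0 \<le> limit_act t x"
    unfolding limit_act_def B.act_def using x t S \<tau>
    by (intro sum_nonneg mult_nonneg_nonneg B.prob_nonneg A.prob_nonneg) auto
  have "limit_act t x \<le> (\<Sum>y\<in>B.reachable x. B.prob \<tau> x y * 1)"
    unfolding limit_act_def B.act_def
  proof (intro sum_mono mult_left_mono)
    fix y assume "y \<in> B.reachable x"
    then show "A.prob (exp (- \<tau>) * t) y z \<le> 1"
      using A.sum_prob_le_1[of y "exp (- \<tau>) * t" "{z}"] S t by simp
  qed (use x \<tau> in \<open>auto intro: B.prob_nonneg\<close>)
  also have "\<dots> \<le> 1" using B.sum_prob_le_1[OF x \<tau>] x by simp
  finally show "limit_act t x \<le> 1" .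
qed

text \<open>The remainder is at most the probability of making n jumps before time t. As \<open>\<phi>\<close> dominates
  the exit rates and grows by one at each jump, the bound is Markov's inequality for a dominating
  Yule process, whose mean grows like \<open>exp t\<close>.\<close>

lemma jump_act_remainder:
  assumes "x \<in> S" "0 \<le> t"
  defines "f \<equiv> \<lambda>y. B.prob \<tau> y z"
  shows "0 \<le> limit_act t x - (\<Sum>k<n. A.jump_act k t f x) \<and>
    limit_act t x - (\<Sum>k<n. A.jump_act k t f x) \<le> exp t * (\<phi> x / (\<phi> x + real n))"
  using assms(1,2)
proof (induction n arbitrary: x t)
  case 0
  have "1 \<le> exp t" using \<open>0 \<le> t\<close> by simp
  with limit_act_bounds[OF 0] \<phi>_pos[OF 0(1)] show ?case by (auto intro: order_trans)
next
  case (Suc n)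
  note x = \<open>x \<in> S\<close>
  define r where "r n t x = limit_act t x - (\<Sum>k<n. A.jump_act k t f x)" for n t x
  define \<rho> where "\<rho> s = (\<Sum>y\<in>A.nbh x. QA x y * r n s y)" for s
  define c where "c = \<phi> x / (\<phi> x + real (Suc n))"
  \<comment> \<open>The truncated equation is subtracted from the full one, so the remainder after
    \<open>Suc n\<close> terms is driven by the neighbours' remainders after n terms.\<close>
  have r': "((\<lambda>t. r (Suc n) t x) has_real_derivative - A.rate x * r (Suc n) s x + \<rho> s)
      (at s within {0..})" if s: "0 \<le> s" for s
  proof -
    have "((\<lambda>t. r (Suc n) t x) has_real_derivative A.gen (limit_act s) x -
        (- A.rate x * (\<Sum>k<Suc n. A.jump_act k s f x)
          + (\<Sum>y\<in>A.nbh x. QA x y * (\<Sum>k<n. A.jump_act k s f y)))) (at s within {0..})"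
      unfolding r_def by (intro DERIV_diff limit_act_deriv A.sum_jump_act_deriv x s)
    moreover have "A.gen (limit_act s) x -
        (- A.rate x * (\<Sum>k<Suc n. A.jump_act k s f x)
          + (\<Sum>y\<in>A.nbh x. QA x y * (\<Sum>k<n. A.jump_act k s f y)))
        = - A.rate x * r (Suc n) s x + \<rho> s"
      by (simp add: A.gen_eq x \<rho>_def r_def algebra_simps sum_subtractf del: sum.lessThan_Suc)
    ultimately show ?thesis by simp
  qed
  have r0: "r (Suc n) 0 x = 0"
    using x by (simp only: r_def limit_act_0 A.sum_jump_act_at_0) (simp add: f_def)
  \<comment> \<open>A jump raises \<phi> by 1, so the neighbours' denominator for n equals the one
    wanted at x for \<open>Suc n\<close>.\<close>
  have IH: "0 \<le> r n s y \<and> r n s y \<le> exp s * ((\<phi> x + 1) / (\<phi> x + 1 + real n))"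
    if "y \<in> A.nbh x" "0 \<le> s" for s y
    using Suc.IH[of y s] A.nbhD[OF that(1) x] that \<phi>_jump[OF x, of y]
    by (auto simp: r_def A.nbh_def)
  have \<rho>_ge: "0 \<le> \<rho> s" if "0 \<le> s" for s
    unfolding \<rho>_def using IH A.nbhD[OF _ x] that by (intro sum_nonneg mult_nonneg_nonneg) auto
  have \<rho>_le: "\<rho> s \<le> (1 + A.rate x) * (exp s * c)" if s: "0 \<le> s" for s
  proof -
    have "\<rho> s \<le> (\<Sum>y\<in>A.nbh x. QA x y * (exp s * ((\<phi> x + 1) / (\<phi> x + 1 + real n))))"
      unfolding \<rho>_def using IH A.nbhD[OF _ x] s by (intro sum_mono mult_left_mono) auto
    also have "\<dots> = exp s * (A.rate x * (\<phi> x + 1)) / (\<phi> x + real (Suc n))"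
      by (simp add: A.rate_eq x sum_distrib_right sum_distrib_left sum_divide_distrib mult_ac add_ac)
    \<comment> \<open>After cancellation this is just rate \<le> \<phi>. The factor 1 + rate is what
      makes \<open>exp s * c\<close> a supersolution.\<close>
    also have "\<dots> \<le> exp s * ((1 + A.rate x) * \<phi> x) / (\<phi> x + real (Suc n))"
      using rate_le_\<phi>[OF x] \<phi>_pos[OF x]
      by (intro divide_right_mono mult_left_mono) (auto simp: algebra_simps)
    finally show ?thesis by (simp add: c_def mult_ac)
  qed
  have "0 \<le> r (Suc n) t x"
    by (rule linear_ode_nonneg[OF r', where a = "A.rate x"]) (use r0 \<rho>_ge Suc.prems in auto)
  moreover have "0 \<le> exp t * c - r (Suc n) t x"
  proof (rule linear_ode_nonneg[where G = "\<lambda>s. exp s * c - r (Suc n) s x" and a = "A.rate x"])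
    fix s :: real assume s: "0 \<le> s"
    show "((\<lambda>s. exp s * c - r (Suc n) s x) has_real_derivative
        exp s * c - (- A.rate x * r (Suc n) s x + \<rho> s)) (at s within {0..})"
      by (intro DERIV_diff r' s) (auto intro!: derivative_eq_intros)
    show "0 \<le> exp s * c - (- A.rate x * r (Suc n) s x + \<rho> s)
        + A.rate x * (exp s * c - r (Suc n) s x)"
      using \<rho>_le[OF s] by (simp add: algebra_simps)
  qed (use r0 \<phi>_pos[OF x] Suc.prems in \<open>auto simp: c_def\<close>)
  ultimately show ?case by (simp add: r_def c_def)
qed

lemma jump_act_sums:
  assumes "x \<in> S" "0 \<le> t"
  shows "(\<lambda>n. A.jump_act n t (\<lambda>y. B.prob \<tau> y z) x) sums limit_act t x"
proof -
  have "(\<lambda>n. exp t * (\<phi> x / (\<phi> x + real n))) \<longlonglongrightarrow> exp t * 0"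
    by (intro tendsto_mult tendsto_const real_tendsto_divide_at_top[OF tendsto_const]
        filterlim_tendsto_add_at_top[OF tendsto_const filterlim_real_sequentially])
  then have lim: "(\<lambda>n. exp t * (\<phi> x / (\<phi> x + real n))) \<longlonglongrightarrow> 0" by simp
  have "(\<lambda>n. limit_act t x - (\<Sum>k<n. A.jump_act k t (\<lambda>y. B.prob \<tau> y z) x)) \<longlonglongrightarrow> 0"
  proof (rule tendsto_sandwich[OF always_eventually always_eventually tendsto_const lim]; intro allI)
    fix n
    note r = jump_act_remainder[OF assms, of n]
    from r show "0 \<le> limit_act t x - (\<Sum>k<n. A.jump_act k t (\<lambda>y. B.prob \<tau> y z) x)" ..
    from r show "limit_act t x - (\<Sum>k<n. A.jump_act k t (\<lambda>y. B.prob \<tau> y z) x)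
        \<le> exp t * (\<phi> x / (\<phi> x + real n))" ..
  qed
  from tendsto_diff[OF tendsto_const[of "limit_act t x"] this] show ?thesis
    by (simp add: sums_def)
qed

end

theorem semigroup_intertwining:
  assumes x: "x \<in> S" and z: "z \<in> S" and t: "0 \<le> t" and \<tau>: "0 \<le> \<tau>"
  shows "(\<Sum>\<^sub>\<infinity>y\<in>S. markov_sg S QA t x y * markov_sg S QB \<tau> y z)
    = (\<Sum>\<^sub>\<infinity>y\<in>S. markov_sg S QB \<tau> x y * markov_sg S QA (exp (- \<tau>) * t) y z)"
proof -
  have "(\<Sum>\<^sub>\<infinity>y\<in>S. markov_sg S QA t x y * markov_sg S QB \<tau> y z)
      = (\<Sum>\<^sub>\<infinity>y\<in>S. markov_sg S QA t x y * ennreal (B.prob \<tau> y z))"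
    using \<tau> by (intro infsum_cong) (simp add: B.markov_sg_eq)
  also have "\<dots> = (\<Sum>n. ennreal (A.jump_act n t (\<lambda>y. B.prob \<tau> y z) x))"
    using x t \<tau> by (intro A.infsum_markov_sg) (auto intro: B.prob_nonneg)
  also have "\<dots> = ennreal (limit_act \<tau> z t x)"
  proof (rule suminf_ennreal_eq[OF _ jump_act_sums[OF \<tau> z x t]])
    show "0 \<le> A.jump_act n t (\<lambda>y. B.prob \<tau> y z) x" for n
      unfolding A.jump_act_def using A.reach_subset[OF x] x t \<tau>
      by (intro sum_nonneg mult_nonneg_nonneg A.jump_prob_nonneg B.prob_nonneg) auto
  qed
  also have "\<dots> = (\<Sum>\<^sub>\<infinity>y\<in>S. markov_sg S QB \<tau> x y * ennreal (A.prob (exp (- \<tau>) * t) y z))"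
    unfolding limit_act_def[OF \<tau> z]
    using x t \<tau> by (intro B.infsum_markov_sg_finite[symmetric]) (auto intro: A.prob_nonneg)
  also have "\<dots> = (\<Sum>\<^sub>\<infinity>y\<in>S. markov_sg S QB \<tau> x y * markov_sg S QA (exp (- \<tau>) * t) y z)"
    using t by (intro infsum_cong) (simp add: A.markov_sg_eq)
  finally show ?thesis .
qed

end

section \<open>The two particle systems\<close>

definition gap :: "(nat \<Rightarrow> int) \<Rightarrow> nat \<Rightarrow> nat" where
  "gap x n = nat (x n - x (Suc n) - 1)"

text \<open>The value 0 at n = 0 encodes x_0 = +infinity, an infinite gap, so that the first
  particle is no special case.\<close>

definition qgap :: "real \<Rightarrow> (nat \<Rightarrow> int) \<Rightarrow> nat \<Rightarrow> real" where
  "qgap q x n = (if n = 0 then 0 else q ^ gap x n)"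

definition up :: "(nat \<Rightarrow> int) \<Rightarrow> nat \<Rightarrow> nat \<Rightarrow> int" where
  "up x n = x(n := x n + 1)"

definition down :: "(nat \<Rightarrow> int) \<Rightarrow> nat \<Rightarrow> nat \<Rightarrow> nat \<Rightarrow> int" where
  "down x n l = x(n := x n - int l)"

text \<open>Equal to (q;q)_g / (q;q)_(g-l) for l \<le> g. For larger l the factor i = g is 1 - q^0 =
  0, so jumps past the next particle get rate 0 and l may run up to any common bound.\<close>

definition qfall :: "real \<Rightarrow> nat \<Rightarrow> nat \<Rightarrow> real" where
  "qfall q g l = (\<Prod>i<l. 1 - q ^ (g - i))"

text \<open>The clock rate n g_n times the jump probability; the factor g_n cancels.\<close>

definition down_rate :: "real \<Rightarrow> (nat \<Rightarrow> int) \<Rightarrow> nat \<Rightarrow> nat \<Rightarrow> real" where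
  "down_rate q x n l = real n * qfall q (gap x n) l / (1 - q ^ l)"

lemma qfall_0 [simp]: "qfall q g 0 = 1"
  by (simp add: qfall_def)

lemma qfall_Suc: "qfall q g (Suc l) = qfall q g l * (1 - q ^ (g - l))"
  by (simp add: qfall_def)

lemma qfall_Suc_Suc: "qfall q (Suc g) (Suc l) = (1 - q ^ Suc g) * qfall q g l"
  unfolding qfall_def by (subst prod.lessThan_Suc_shift) simp

lemma qfall_eq_0: "g < l \<Longrightarrow> qfall q g l = 0"
  unfolding qfall_def by (rule prod_zero) (auto intro: bexI[of _ g])

lemma qpoch_q_eq_qfall: "l \<le> g \<Longrightarrow> qpoch_q q g = qfall q g l * qpoch_q q (g - l)"
proof (induction l)
  case (Suc l)
  then obtain d where "g = Suc (l + d)" using less_eqE[of "Suc l" g] by auto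
  with Suc show ?case by (simp add: qpoch_q_def qfall_Suc Suc_diff_le algebra_simps)
qed simp

locale q_parameter =
  fixes q :: real
  assumes q_nonneg: "0 \<le> q" and q_less_1: "q < 1"
begin

lemma power_q_less_1: "0 < l \<Longrightarrow> q ^ l < 1"
  using q_nonneg q_less_1 by (simp add: power_less_one_iff)

lemma power_q_le_1: "q ^ l \<le> 1"
  using q_nonneg q_less_1 by (simp add: power_le_one)

lemma qfall_nonneg: "0 \<le> qfall q g l"
  unfolding qfall_def by (intro prod_nonneg) (auto simp: power_q_le_1)

lemma qpoch_q_pos: "0 < qpoch_q q n"
  unfolding qpoch_q_def by (intro prod_pos) (use power_q_less_1[of "Suc _"] in auto)

text \<open>The jump probabilities of the backwards q-TASEP sum to one: increasing g by one adds
  \<open>\<Sum>i\<le>g. qfall q g i * q ^ (g - i)\<close> to the left-hand side, which telescopes.\<close>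

lemma sum_qfall_divide:
  assumes "g \<le> L"
  shows "(\<Sum>l = 1..L. qfall q g l / (1 - q ^ l)) = real g"
  using assms
proof (induction g)
  case 0
  have "(\<Sum>l = 1..L. qfall q 0 l / (1 - q ^ l)) = 0"
    by (intro sum.neutral) (auto simp: qfall_eq_0)
  then show ?case by simp
next
  case (Suc g)
  have diff: "qfall q (Suc g) (Suc l) / (1 - q ^ Suc l)
      = qfall q g (Suc l) / (1 - q ^ Suc l) + (qfall q g l - qfall q g (Suc l))" for l
  proof (cases "l \<le> g")
    case True
    have "q ^ Suc g = q ^ (g - l) * q ^ Suc l"
      using True by (simp flip: power_add)
    moreover have "1 - q ^ Suc l \<noteq> 0" using power_q_less_1[of "Suc l"] by simp
    ultimately show ?thesis
      unfolding qfall_Suc_Suc qfall_Suc[of q g]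
      by (simp add: divide_simps del: power_Suc) (simp add: algebra_simps)
  qed (simp add: qfall_eq_0 qfall_Suc_Suc)
  have "(\<Sum>l = 1..L. qfall q (Suc g) l / (1 - q ^ l))
      = (\<Sum>l<L. qfall q (Suc g) (Suc l) / (1 - q ^ Suc l))"
    by (simp only: One_nat_def sum.atLeast1_atMost_eq)
  also have "\<dots> = (\<Sum>l<L. qfall q g (Suc l) / (1 - q ^ Suc l)) + (\<Sum>l<L. qfall q g l - qfall q g (Suc l))"
    by (simp only: diff sum.distrib)
  also have "(\<Sum>l<L. qfall q g (Suc l) / (1 - q ^ Suc l)) = real g"
    using Suc by (simp add: sum.atLeast1_atMost_eq)
  also have "(\<Sum>l<L. qfall q g l - qfall q g (Suc l)) = 1"
    using Suc.prems by (simp only: sum_lessThan_telescope') (simp add: qfall_eq_0)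
  finally show ?case by simp
qed

end

section \<open>Configurations, gaps and size\<close>

lemma XX_less: "x \<in> XX \<Longrightarrow> 1 \<le> n \<Longrightarrow> x (Suc n) < x n"
  by (simp add: XX_def)

lemma XX_obtain_packed:
  assumes "x \<in> XX"
  obtains K where "1 \<le> K" "\<And>n. K \<le> n \<Longrightarrow> x n = - int n"
proof -
  from assms obtain N where "\<forall>n\<ge>N. x n = - int n" by (auto simp: XX_def)
  then show thesis by (intro that[of "Suc N"]) auto
qed

lemma int_gap: "x \<in> XX \<Longrightarrow> 1 \<le> n \<Longrightarrow> int (gap x n) = x n - x (Suc n) - 1"
  using XX_less[of x n] by (simp add: gap_def)

lemma gap_packed: "(\<And>n. K \<le> n \<Longrightarrow> x n = - int n) \<Longrightarrow> K \<le> n \<Longrightarrow> gap x n = 0"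
  by (simp add: gap_def)

lemma qtasep_rate_eq: "1 \<le> n \<Longrightarrow> qtasep_rate q x n = 1 - qgap q x (n - 1)"
  by (auto simp: qtasep_rate_def qgap_def gap_def)

lemma up_inj: "up x n = up x m \<longleftrightarrow> n = m"
  by (auto simp: up_def fun_eq_iff split: if_splits)

lemma up_ne: "up x n \<noteq> x"
  by (auto simp: up_def fun_eq_iff)

lemma down_inj: "0 < l \<Longrightarrow> down x n l = down x m k \<longleftrightarrow> n = m \<and> l = k"
  by (auto simp: down_def fun_eq_iff split: if_splits)

lemma down_ne: "0 < l \<Longrightarrow> down x n l \<noteq> x"
  by (auto simp: down_def fun_eq_iff)

lemma down_up: "down (up x m) k l = up (down x k l) m"
  by (auto simp: down_def up_def)

lemma gap_up:
  assumes "x \<in> XX" "1 \<le> n"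
  shows "gap (up x m) n = (if n = m then gap x n + 1 else if Suc n = m then gap x n - 1 else gap x n)"
  using XX_less[OF assms] by (auto simp: gap_def up_def)

lemma gap_down:
  assumes "x \<in> XX" "1 \<le> n"
  shows "gap (down x m l) n = (if n = m then gap x n - l else if Suc n = m then gap x n + l else gap x n)"
  using XX_less[OF assms] by (auto simp: gap_def down_def)

text \<open>The exclusion rule sits in the rate: a blocked particle has gap 0 in front of it and
  hence rate 1 - q^0 = 0, also for q = 0.\<close>

lemma up_in_XX:
  assumes x: "x \<in> XX" and n: "1 \<le> n" and r: "qtasep_rate q x n \<noteq> 0"
  shows "up x n \<in> XX"
proof -
  have "x n + 1 < x (n - 1)" if "n \<noteq> 1"
    using r that by (cases "x (n - 1) - x n - 1 \<le> 0") (auto simp: qtasep_rate_def)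
  then have "\<forall>k\<ge>1. up x n (Suc k) < up x n k"
    using XX_less[OF x] by (force simp: up_def)
  moreover from x obtain N where "\<forall>n\<ge>N. x n = - int n" by (auto simp: XX_def)
  then have "\<forall>k\<ge>max N (Suc n). up x n k = - int k" by (auto simp: up_def)
  moreover have "up x n 0 = 0" using x n by (auto simp: XX_def up_def)
  ultimately show ?thesis unfolding XX_def by blast
qed

lemma down_in_XX:
  assumes x: "x \<in> XX" and n: "1 \<le> n" and l: "l \<le> gap x n"
  shows "down x n l \<in> XX"
proof -
  have "x (Suc n) < x n - int l" using int_gap[OF x n] l by simp
  then have "\<forall>k\<ge>1. down x n l (Suc k) < down x n l k"
    using XX_less[OF x] by (force simp: down_def)
  moreover from x obtain N where "\<forall>n\<ge>N. x n = - int n" by (auto simp: XX_def)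
  then have "\<forall>k\<ge>max N (Suc n). down x n l k = - int k" by (auto simp: down_def)
  moreover have "down x n l 0 = 0" using x n by (auto simp: XX_def down_def)
  ultimately show ?thesis unfolding XX_def by blast
qed

text \<open>The size of the partition with parts x_n + n.\<close>

definition config_size :: "(nat \<Rightarrow> int) \<Rightarrow> int" where
  "config_size x = (\<Sum>n | 1 \<le> n \<and> x n \<noteq> - int n. x n + int n)"

lemma config_size_eq:
  assumes "\<And>n. K \<le> n \<Longrightarrow> x n = - int n"
  shows "config_size x = (\<Sum>n = 1..<K. x n + int n)"
  unfolding config_size_def
  by (rule sum.mono_neutral_left) (use assms in \<open>auto simp: not_le[symmetric]\<close>)

lemma config_size_update:
  assumes x: "x \<in> XX" and n: "1 \<le> n"
  shows "config_size (x(n := m)) = config_size x + (m - x n)"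
proof -
  obtain K where K: "1 \<le> K" "\<And>n. K \<le> n \<Longrightarrow> x n = - int n" using x by (rule XX_obtain_packed) blast
  define M where "M = max K (Suc n)"
  have "config_size x = (\<Sum>n = 1..<M. x n + int n)" by (rule config_size_eq) (auto simp: M_def K)
  also have "\<dots> = (x n + int n) + (\<Sum>k\<in>{1..<M} - {n}. x k + int k)"
    by (rule sum.remove) (use n in \<open>auto simp: M_def\<close>)
  finally have 1: "config_size x = (x n + int n) + (\<Sum>k\<in>{1..<M} - {n}. x k + int k)" .
  have "config_size (x(n := m)) = (\<Sum>k = 1..<M. (x(n := m)) k + int k)" by (rule config_size_eq) (auto simp: M_def K)
  also have "\<dots> = ((x(n := m)) n + int n) + (\<Sum>k\<in>{1..<M} - {n}. (x(n := m)) k + int k)"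
    by (rule sum.remove) (use n in \<open>auto simp: M_def\<close>)
  also have "(\<Sum>k\<in>{1..<M} - {n}. (x(n := m)) k + int k) = (\<Sum>k\<in>{1..<M} - {n}. x k + int k)"
    by (rule sum.cong) auto
  finally show ?thesis using 1 by (simp del: fun_upd_apply) simp
qed

lemma config_size_up: "x \<in> XX \<Longrightarrow> 1 \<le> n \<Longrightarrow> config_size (up x n) = config_size x + 1"
  by (simp add: up_def config_size_update)

lemma config_size_down: "x \<in> XX \<Longrightarrow> 1 \<le> n \<Longrightarrow> config_size (down x n l) = config_size x - int l"
  by (simp add: down_def config_size_update)

text \<open>The sequence x_n + n is weakly decreasing and eventually 0.\<close>

lemma XX_ge:
  assumes x: "x \<in> XX" and n: "1 \<le> n"
  shows "0 \<le> x n + int n"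
proof -
  have mono: "x (n + d) + int d \<le> x n" for d
  proof (induction d)
    case (Suc d)
    then show ?case using XX_less[OF x, of "n + d"] n by simp
  qed simp
  obtain K where "1 \<le> K" "\<And>n. K \<le> n \<Longrightarrow> x n = - int n" using x by (rule XX_obtain_packed) blast
  then show ?thesis using mono[of K] by simp
qed

lemma config_size_nonneg: "x \<in> XX \<Longrightarrow> 0 \<le> config_size x"
  unfolding config_size_def by (rule sum_nonneg) (auto intro: XX_ge)

section \<open>Jump rates in terms of elementary moves\<close>

lemma qtasep_Q_up:
  assumes "1 \<le> n"
  shows "qtasep_Q q x (up x n) = qtasep_rate q x n"
proof -
  have "qtasep_Q q x (up x n) = infsum (qtasep_rate q x) {n}"
    unfolding qtasep_Q_def up_def[symmetric]
    by (rule infsum_cong_neutral) (use assms in \<open>auto simp: up_inj\<close>)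
  then show ?thesis by simp
qed

lemma qtasep_Q_nonzeroE:
  assumes "qtasep_Q q x y \<noteq> 0"
  obtains n where "1 \<le> n" "y = up x n"
proof -
  have "\<exists>n\<ge>1. y = up x n"
  proof (rule ccontr)
    assume "\<not> ?thesis"
    then have "qtasep_Q q x y = 0"
      unfolding qtasep_Q_def up_def by (intro infsum_0) auto
    with assms show False by simp
  qed
  then show thesis using that by blast
qed

context q_parameter
begin

lemma back_rate_down:
  assumes x: "x \<in> XX" and n: "1 \<le> n" and l: "0 < l" "l \<le> gap x n"
  shows "back_rate q x n (x n - int l) = down_rate q x n l"
proof -
  have g: "nat (x n - x (Suc n) - 1) = gap x n" by (simp add: gap_def)
  have g': "nat (x n - int l - x (Suc n) - 1) = gap x n - l" by (simp add: gap_def)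
  have "qpoch_q q (gap x n - l) \<noteq> 0"
    using qpoch_q_pos by (simp add: less_imp_neq[symmetric])
  then show ?thesis
    using l qpoch_q_eq_qfall[OF l(2), of q]
    by (simp add: back_rate_def g g' Let_def down_rate_def)
qed

lemma back_Q_down:
  assumes x: "x \<in> XX" and n: "1 \<le> n" and l: "0 < l" "l \<le> gap x n"
  shows "back_Q q x (down x n l) = down_rate q x n l"
proof -
  \<comment> \<open>A configuration lowered in one coordinate determines the particle and its
    target, so the defining sum reduces to one term.\<close>
  have upd: "down x n l = x(k := m) \<longleftrightarrow> k = n \<and> m = x n - int l" if "m < x k" for k m
    using that l(1) by (auto simp: down_def fun_eq_iff split: if_splits)
  have "x (Suc n) < x n - int l" using int_gap[OF x n] l by simp
  then have "back_Q q x (down x n l) = infsum (\<lambda>(n, m). back_rate q x n m) {(n, x n - int l)}"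
    unfolding back_Q_def
    by (intro infsum_cong_neutral) (use l n in \<open>auto simp: upd split: if_splits\<close>)
  then show ?thesis using back_rate_down[OF assms] by simp
qed

lemma back_Q_nonzeroE:
  assumes x: "x \<in> XX" and "back_Q q x y \<noteq> 0"
  obtains n l where "1 \<le> n" "0 < l" "l \<le> gap x n" "y = down x n l"
proof -
  have "\<exists>n m. 1 \<le> n \<and> x (Suc n) < m \<and> m < x n \<and> y = x(n := m)"
  proof (rule ccontr)
    assume *: "\<not> ?thesis"
    have "back_Q q x y = 0"
      unfolding back_Q_def by (intro infsum_0) (use * in auto)
    with assms show False by simp
  qed
  then obtain n m where "1 \<le> n" "x (Suc n) < m" "m < x n" "y = x(n := m)" by blast
  then show thesis by (intro that[of n "nat (x n - m)"]) (auto simp: gap_def down_def)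
qed

lemma qtasep_rate_nonneg: "0 \<le> qtasep_rate q x n"
  using power_q_le_1 by (simp add: qtasep_rate_def)

lemma down_rate_nonneg: "0 \<le> down_rate q x n l"
  unfolding down_rate_def using power_q_le_1 qfall_nonneg
  by (intro divide_nonneg_nonneg mult_nonneg_nonneg) auto

text \<open>\<open>K < n\<close> is strict: particle K can still jump, since its rate depends on the
  gap in front of it, of index K - 1.\<close>

lemma qtasep_rate_eq_0:
  assumes "\<And>n. K \<le> n \<Longrightarrow> gap x n = 0" "1 \<le> K" "K < n"
  shows "qtasep_rate q x n = 0"
  using assms by (simp add: qtasep_rate_eq qgap_def)

text \<open>Jumps to the right raise the size, hence the sign; this level is not bounded
  below.\<close>

sublocale A: graded_rates XX "qtasep_Q q" "\<lambda>x. - config_size x"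
proof
  fix x y assume x: "x \<in> XX"
  show "0 \<le> qtasep_Q q x y"
    unfolding qtasep_Q_def by (intro infsum_nonneg) (auto simp: qtasep_rate_nonneg)
  obtain K where K: "1 \<le> K" "\<And>n. K \<le> n \<Longrightarrow> x n = - int n" using x by (rule XX_obtain_packed) blast
  have "{y \<in> XX - {x}. qtasep_Q q x y \<noteq> 0} \<subseteq> up x ` {1..K}"
  proof
    fix y assume "y \<in> {y \<in> XX - {x}. qtasep_Q q x y \<noteq> 0}"
    then have Q: "qtasep_Q q x y \<noteq> 0" by simp
    then obtain n where n: "1 \<le> n" "y = up x n" by (rule qtasep_Q_nonzeroE)
    with Q have "qtasep_rate q x n \<noteq> 0" by (simp add: qtasep_Q_up)
    then have "n \<le> K" using qtasep_rate_eq_0[of K x n] gap_packed[OF K(2)] K(1) by force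
    with n show "y \<in> up x ` {1..K}" by auto
  qed
  then show "finite {y \<in> XX - {x}. qtasep_Q q x y \<noteq> 0}" by (rule finite_subset) simp
  show "- config_size y < - config_size x" if "qtasep_Q q x y \<noteq> 0"
    using that x by (auto elim!: qtasep_Q_nonzeroE simp: config_size_up)
qed

sublocale B: graded_rates XX "back_Q q" config_size
proof
  fix x y assume x: "x \<in> XX"
  show "0 \<le> back_Q q x y"
  proof (cases "back_Q q x y = 0")
    case False
    with x obtain n l where "1 \<le> n" "0 < l" "l \<le> gap x n" "y = down x n l"
      by (rule back_Q_nonzeroE)
    with x show ?thesis by (simp add: back_Q_down down_rate_nonneg)
  qed simp
  obtain K where K: "1 \<le> K" "\<And>n. K \<le> n \<Longrightarrow> x n = - int n" using x by (rule XX_obtain_packed) blast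
  have "{y \<in> XX - {x}. back_Q q x y \<noteq> 0} \<subseteq> (\<Union>n\<in>{1..K}. down x n ` {1..gap x n})"
  proof
    fix y assume "y \<in> {y \<in> XX - {x}. back_Q q x y \<noteq> 0}"
    then have "back_Q q x y \<noteq> 0" by simp
    with x obtain n l where n: "1 \<le> n" "0 < l" "l \<le> gap x n" "y = down x n l"
      by (rule back_Q_nonzeroE)
    then have "n \<le> K" using gap_packed[OF K(2), of n] by force
    with n show "y \<in> (\<Union>n\<in>{1..K}. down x n ` {1..gap x n})" by (auto intro!: bexI[of _ n])
  qed
  then show "finite {y \<in> XX - {x}. back_Q q x y \<noteq> 0}" by (rule finite_subset) simp
  show "config_size y < config_size x" if "back_Q q x y \<noteq> 0"
    by (rule back_Q_nonzeroE[OF x that]) (simp add: config_size_down x)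
qed

section \<open>The generators as finite sums over particles\<close>

lemma sum_A_nbh:
  assumes x: "x \<in> XX" and K: "1 \<le> K" "\<And>n. K \<le> n \<Longrightarrow> gap x n = 0"
  shows "(\<Sum>y\<in>A.nbh x. qtasep_Q q x y * F y) = (\<Sum>m = 1..K. qtasep_rate q x m * F (up x m))"
proof (rule A.sum_nbh_reindex)
  show "inj_on (up x) {1..K}" by (auto simp: inj_on_def up_inj)
  show "up x m \<in> XX - {x} \<and> qtasep_Q q x (up x m) = qtasep_rate q x m"
    if "m \<in> {1..K}" "qtasep_rate q x m \<noteq> 0" for m
    using that x by (auto simp: up_ne qtasep_Q_up up_in_XX)
  fix y assume Q: "qtasep_Q q x y \<noteq> 0"
  then obtain n where n: "1 \<le> n" "y = up x n" by (rule qtasep_Q_nonzeroE)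
  with Q have r: "qtasep_rate q x n \<noteq> 0" by (simp add: qtasep_Q_up)
  then have "n \<le> K" using qtasep_rate_eq_0[OF K(2,1), of n] by force
  with n r show "\<exists>m\<in>{1..K}. y = up x m \<and> qtasep_rate q x m \<noteq> 0" by auto
qed simp

lemma A_gen:
  assumes "x \<in> XX" and "1 \<le> K" "\<And>n. K \<le> n \<Longrightarrow> gap x n = 0"
  shows "A.gen f x = (\<Sum>m = 1..K. qtasep_rate q x m * (f (up x m) - f x))"
  unfolding A.gen_def by (rule sum_A_nbh) fact+

lemma down_rate_eq_0: "gap x n < l \<Longrightarrow> down_rate q x n l = 0"
  by (simp add: down_rate_def qfall_eq_0)

text \<open>Gap K is left free because the formula is also applied after a jump of particle K, which
  opens that gap.\<close>

lemma B_gen: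
  assumes x: "x \<in> XX" and K: "\<And>n. K < n \<Longrightarrow> gap x n = 0" and L: "\<And>n. 1 \<le> n \<Longrightarrow> gap x n \<le> L"
  shows "B.gen f x = (\<Sum>k = 1..K. \<Sum>l = 1..L. down_rate q x k l * (f (down x k l) - f x))"
proof -
  have "B.gen f x = (\<Sum>i\<in>{1..K} \<times> {1..L}. (case i of (k, l) \<Rightarrow> down_rate q x k l) *
      (f (case i of (k, l) \<Rightarrow> down x k l) - f x))"
    unfolding B.gen_def
  proof (rule B.sum_nbh_reindex)
    show "inj_on (\<lambda>(k, l). down x k l) ({1..K} \<times> {1..L})" by (auto simp: inj_on_def down_inj)
  next
    fix i assume "i \<in> {1..K} \<times> {1..L}" "(case i of (k, l) \<Rightarrow> down_rate q x k l) \<noteq> 0"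
    then obtain k l where i: "i = (k, l)" "1 \<le> k" "1 \<le> l" "l \<le> gap x k"
      by (cases i) (force simp: down_rate_eq_0 not_less[symmetric])
    then show "(case i of (k, l) \<Rightarrow> down x k l) \<in> XX - {x} \<and>
        back_Q q x (case i of (k, l) \<Rightarrow> down x k l) = (case i of (k, l) \<Rightarrow> down_rate q x k l)"
      using x by (auto simp: down_ne down_in_XX back_Q_down)
  next
    fix y assume Q: "back_Q q x y \<noteq> 0"
    with x obtain n l where n: "1 \<le> n" "0 < l" "l \<le> gap x n" "y = down x n l"
      by (rule back_Q_nonzeroE)
    with Q x have r: "down_rate q x n l \<noteq> 0" by (simp add: back_Q_down)
    have "n \<le> K" using K[of n] n by force
    moreover have "l \<le> L" using L[of n] n by simp
    ultimately show "\<exists>i\<in>{1..K} \<times> {1..L}. y = (case i of (k, l) \<Rightarrow> down x k l) \<and>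
        (case i of (k, l) \<Rightarrow> down_rate q x k l) \<noteq> 0"
      using n r by force
  qed simp
  then show ?thesis by (simp add: sum.cartesian_product split_beta)
qed

text \<open>Particle 1 contributes 1, and \<open>1 - q ^ g \<le> g\<close> bounds the others by the
  sum of the gaps. That sum telescopes to x 1 + 1, the largest part of the partition.\<close>

lemma exit_rate_le:
  assumes x: "x \<in> XX"
  shows "exit_rate XX (qtasep_Q q) x \<le> 1 + real_of_int (config_size x)"
proof -
  obtain K where K: "1 \<le> K" "\<And>n. K \<le> n \<Longrightarrow> x n = - int n" using x by (rule XX_obtain_packed) blast
  have g0: "gap x n = 0" if "K \<le> n" for n using K(2) that by (rule gap_packed)
  have le: "1 - q ^ g \<le> real g" for g :: nat
    using zero_le_power[OF q_nonneg, of g] by (cases "g = 0") auto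
  have "exit_rate XX (qtasep_Q q) x = (\<Sum>m = 1..K. qtasep_rate q x m)"
    using sum_A_nbh[OF x K(1) g0, of "\<lambda>_. 1"] x by (simp add: A.rate_eq)
  also have "\<dots> = (\<Sum>n<K. 1 - qgap q x n)"
    by (simp add: sum.atLeast1_atMost_eq qtasep_rate_eq)
  also have "\<dots> = 1 + (\<Sum>n = 1..<K. 1 - q ^ gap x n)"
    using K(1) by (simp add: lessThan_atLeast0 sum.atLeast_Suc_lessThan qgap_def)
  also have "\<dots> \<le> 1 + (\<Sum>n = 1..<K. real (gap x n))"
    by (intro add_left_mono sum_mono le)
  also have "(\<Sum>n = 1..<K. real (gap x n)) = real_of_int (\<Sum>n = 1..<K. (x n + int n) - (x (Suc n) + int (Suc n)))"
    unfolding of_int_sum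
  proof (intro sum.cong refl)
    fix n assume "n \<in> {1..<K}"
    then have "int (gap x n) = (x n + int n) - (x (Suc n) + int (Suc n))" by (simp add: int_gap x)
    from arg_cong[OF this, of real_of_int]
    show "real (gap x n) = real_of_int ((x n + int n) - (x (Suc n) + int (Suc n)))" by simp
  qed
  also have "(\<Sum>n = 1..<K. (x n + int n) - (x (Suc n) + int (Suc n))) = x 1 + 1"
    using K sum_Suc_diff'[OF K(1), of "\<lambda>n. - (x n + int n)"] by (simp add: algebra_simps)
  also have "x 1 + 1 \<le> config_size x"
  proof (cases "K = 1")
    case True
    with K(2)[of 1] config_size_nonneg[OF x] show ?thesis by simp
  next
    case False
    have "x 1 + int 1 \<le> (\<Sum>n = 1..<K. x n + int n)"
      by (rule member_le_sum) (use False K(1) XX_ge[OF x] in auto)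
    also have "\<dots> = config_size x" by (rule config_size_eq[symmetric]) (rule K(2))
    finally show ?thesis by simp
  qed
  finally show ?thesis by simp
qed

section \<open>The commutation relation of the generators\<close>

lemma rates_commute:
  assumes x: "x \<in> XX" and k: "1 \<le> k" and m: "1 \<le> m" and "m \<noteq> k"
  shows "down_rate q x k l * qtasep_rate q (down x k l) m = qtasep_rate q x m * down_rate q (up x m) k l"
proof (cases "m = Suc k")
  case True
  \<comment> \<open>The rate of particle k + 1 and the jump rate of particle k involve the same gap
    k. Both sides equal \<open>qfall q g (Suc l)\<close>.\<close>
  have "qfall q g l * (1 - q ^ (g - l)) = (1 - q ^ g) * qfall q (g - 1) l" for g
    by (cases g) (simp_all flip: qfall_Suc add: qfall_Suc_Suc qfall_eq_0)
  with True k x show ?thesis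
    by (simp add: qtasep_rate_eq qgap_def gap_down gap_up down_rate_def)
next
  case False
  have "qgap q (down x k l) (m - 1) = qgap q x (m - 1)"
    using False \<open>m \<noteq> k\<close> x by (auto simp: qgap_def gap_down)
  moreover have "gap (up x m) k = gap x k"
    using False \<open>m \<noteq> k\<close> x k by (auto simp: gap_up)
  ultimately show ?thesis
    using m by (simp add: qtasep_rate_eq down_rate_def)
qed

lemma qgap_down_prev:
  assumes "x \<in> XX" "1 \<le> k"
  shows "qgap q (down x k l) (k - 1) = qgap q x (k - 1) * q ^ l"
  using assms by (auto simp: qgap_def gap_down power_add)

text \<open>With p, w, G as in the proof, \<open>(1 - p) * (1 - G * w) - (1 - G) * (1 - p * w) = (G
  - p) * (1 - w)\<close>, which cancels the denominator. The index is \<open>Suc j\<close> because j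
  + 1 steps down and one up amount to j steps down.\<close>

lemma rates_commutator_same:
  assumes x: "x \<in> XX" and k: "1 \<le> k"
  shows "down_rate q x k (Suc j) * qtasep_rate q (down x k (Suc j)) k
      - qtasep_rate q x k * down_rate q (up x k) k (Suc j)
    = real k * qfall q (gap x k) j * (qgap q x (k - 1) - q ^ (gap x k - j))"
proof -
  define g p w G where "g = gap x k" and "p = q ^ (g - j)" and "w = q ^ Suc j"
    and "G = qgap q x (k - 1)"
  have w: "1 - w \<noteq> 0" using power_q_less_1[of "Suc j"] by (simp add: w_def)
  have 1: "down_rate q x k (Suc j) = real k * (qfall q g j * (1 - p)) / (1 - w)"
    by (simp only: down_rate_def qfall_Suc g_def p_def w_def)
  have 2: "qtasep_rate q (down x k (Suc j)) k = 1 - G * w"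
    using qgap_down_prev[OF x k, of "Suc j"] k by (simp only: qtasep_rate_eq G_def w_def)
  have 3: "qtasep_rate q x k = 1 - G" using k by (simp only: qtasep_rate_eq G_def)
  have 4: "down_rate q (up x k) k (Suc j) = real k * ((1 - q ^ Suc g) * qfall q g j) / (1 - w)"
    using gap_up[OF x k, of k] by (simp only: down_rate_def g_def w_def qfall_Suc_Suc) (simp add: qfall_Suc_Suc)
  show ?thesis
  proof (cases "j \<le> g")
    case True
    then have 5: "q ^ Suc g = p * w" by (simp add: p_def w_def flip: power_add power_Suc)
    show ?thesis
      unfolding 1 2 3 4 5 g_def[symmetric] p_def[symmetric] G_def[symmetric]
      using w by (simp add: divide_simps) (simp add: algebra_simps)
  next
    case False
    then show ?thesis unfolding 1 2 3 4 g_def[symmetric] by (simp add: qfall_eq_0)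
  qed
qed

text \<open>Only gaps k - 1 and k change, hence only the rates of particles k and k + 1;
  \<open>k < K\<close> keeps the latter in the sum. The factor \<open>1 - q ^ j\<close> will cancel
  the denominator of \<open>down_rate\<close>.\<close>

lemma qtasep_rates_down:
  assumes x: "x \<in> XX" and k: "1 \<le> k" "k < K" and j: "j \<le> gap x k"
  shows "(\<Sum>m = 1..K. qtasep_rate q x m - qtasep_rate q (down x k j) m)
    = (1 - q ^ j) * (q ^ (gap x k - j) - qgap q x (k - 1))"
proof -
  have "(\<Sum>m = 1..K. qtasep_rate q x m - qtasep_rate q (down x k j) m)
      = (\<Sum>n<K. qgap q (down x k j) n - qgap q x n)"
    by (simp add: sum.atLeast1_atMost_eq qtasep_rate_eq)
  also have "\<dots> = (\<Sum>n\<in>{k - 1, k}. qgap q (down x k j) n - qgap q x n)"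
    using x k by (intro sum.mono_neutral_right) (auto simp: qgap_def gap_down)
  also have "\<dots> = (qgap q x (k - 1) * q ^ j - qgap q x (k - 1)) + (q ^ (gap x k - j) - q ^ gap x k)"
    using x k by (subst sum.insert) (auto simp: qgap_down_prev qgap_def gap_down power_add)
  also have "q ^ gap x k = q ^ (gap x k - j) * q ^ j"
    using j by (simp flip: power_add)
  finally show ?thesis by (simp add: algebra_simps)
qed

lemma sum_down_rate:
  assumes "\<And>n. 1 \<le> n \<Longrightarrow> gap x n \<le> L"
  shows "(\<Sum>k = 1..K. \<Sum>l = 1..L. down_rate q x k l) = (\<Sum>k = 1..K. real k * real (gap x k))"
proof (intro sum.cong refl)
  fix k assume "k \<in> {1..K}"
  then show "(\<Sum>l = 1..L. down_rate q x k l) = real k * real (gap x k)"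
    using sum_qfall_divide[of "gap x k" L] assms[of k]
    by (simp add: down_rate_def sum_distrib_left[symmetric] flip: times_divide_eq_right)
qed

text \<open>Gap m grows by one and, for m > 1, gap m - 1 shrinks by one, so the total clock rate
  changes by m - (m - 1). The nonzero rate ensures that the shrinking gap was positive.\<close>

lemma down_rates_up:
  assumes x: "x \<in> XX" and m: "1 \<le> m" "m \<le> K" and r: "qtasep_rate q x m \<noteq> 0"
    and L: "\<And>n. 1 \<le> n \<Longrightarrow> gap x n < L"
  shows "(\<Sum>k = 1..K. \<Sum>l = 1..L. down_rate q (up x m) k l - down_rate q x k l) = 1"
proof -
  have "gap x n \<le> L" "gap (up x m) n \<le> L" if "1 \<le> n" for n
    using L[OF that] x that by (auto simp: gap_up)
  then have "(\<Sum>k = 1..K. \<Sum>l = 1..L. down_rate q (up x m) k l - down_rate q x k l)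
      = (\<Sum>k = 1..K. real k * real (gap (up x m) k) - real k * real (gap x k))"
    by (simp only: sum_subtractf sum_down_rate)
  also have "\<dots> = (\<Sum>k = 1..K. (if k = m then real m else 0) - (if k = m - 1 then real (m - 1) else 0))"
  proof (intro sum.cong refl)
    fix k assume k: "k \<in> {1..K}"
    have "gap x k \<noteq> 0" if "Suc k = m"
      using r that k by (intro notI) (auto simp: qtasep_rate_eq qgap_def)
    then show "real k * real (gap (up x m) k) - real k * real (gap x k)
        = (if k = m then real m else 0) - (if k = m - 1 then real (m - 1) else 0)"
      using k x m by (auto simp: gap_up algebra_simps of_nat_diff)
  qed
  also have "\<dots> = 1"
    using m by (auto simp: sum_subtractf of_nat_diff)
  finally show ?thesis .
qed

text \<open>Terms are sorted by where f is evaluated: after down and up, after down only, after up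
  only. The last group yields the gain part of \<open>A.gen f x\<close>; the first two cancel up to
  a boundary term, the loss part at x.\<close>

lemma commutator:
  assumes x: "x \<in> XX"
  shows "B.gen (A.gen f) x - A.gen (B.gen f) x = A.gen f x"
proof -
  obtain K where K: "1 \<le> K" "\<And>n. K \<le> n \<Longrightarrow> x n = - int n" using x by (rule XX_obtain_packed) blast
  have g0: "gap x n = 0" if "K \<le> n" for n using K(2) that by (rule gap_packed)
  \<comment> \<open>The extra 1 keeps L an upper bound for the gaps after an upward jump.\<close>
  define L where "L = Suc (\<Sum>n\<le>K. gap x n)"
  have L: "gap x n < L" for n
    using g0[of n] member_le_sum[of n "{..K}" "gap x"] by (cases "n \<le> K") (auto simp: L_def)
  define \<alpha> where "\<alpha> y m = qtasep_rate q y m" for y m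
  define \<beta> where "\<beta> y k l = down_rate q y k l" for y k l
  have \<beta>_nz: "1 \<le> l \<Longrightarrow> l \<le> gap x k \<and> k < K" if "\<beta> x k l \<noteq> 0" for k l
    using that down_rate_eq_0[of x k l] g0[of k] by (force simp: \<beta>_def not_le[symmetric])
  have gL: "gap x n \<le> L" for n using L[of n] by simp
  have Bx: "B.gen h x = (\<Sum>k = 1..K. \<Sum>l = 1..L. \<beta> x k l * (h (down x k l) - h x))" for h
    unfolding \<beta>_def by (rule B_gen) (use x g0 gL in auto)
  have Ax: "A.gen h x = (\<Sum>m = 1..K. \<alpha> x m * (h (up x m) - h x))" for h
    unfolding \<alpha>_def by (rule A_gen) (use x K(1) g0 in auto)
  \<comment> \<open>The factor \<open>\<beta> x k l\<close> stays in the statement because the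
    lowered configuration need not lie in \<open>XX\<close> when this rate is 0.\<close>
  have AD: "\<beta> x k l * A.gen f (down x k l)
      = \<beta> x k l * (\<Sum>m = 1..K. \<alpha> (down x k l) m * (f (up (down x k l) m) - f (down x k l)))"
    if "k \<in> {1..K}" "l \<in> {1..L}" for k l
  proof (cases "\<beta> x k l = 0")
    case False
    then have "l \<le> gap x k" "k < K" using \<beta>_nz that by auto
    then have "A.gen f (down x k l)
        = (\<Sum>m = 1..K. \<alpha> (down x k l) m * (f (up (down x k l) m) - f (down x k l)))"
      unfolding \<alpha>_def using x that K(1) by (intro A_gen down_in_XX) (auto simp: gap_down g0)
    then show ?thesis by simp
  qed simp
  have BU: "\<alpha> x m * B.gen f (up x m)
      = \<alpha> x m * (\<Sum>k = 1..K. \<Sum>l = 1..L. \<beta> (up x m) k l * (f (up (down x k l) m) - f (up x m)))"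
    if "m \<in> {1..K}" for m
  proof (cases "\<alpha> x m = 0")
    case False
    have "gap (up x m) n \<le> L" if "1 \<le> n" for n using L[of n] x that by (auto simp: gap_up)
    then have "B.gen f (up x m)
        = (\<Sum>k = 1..K. \<Sum>l = 1..L. \<beta> (up x m) k l * (f (down (up x m) k l) - f (up x m)))"
      unfolding \<beta>_def using False x that
      by (intro B_gen) (auto intro!: up_in_XX[of x m q] simp: \<alpha>_def gap_up g0)
    then show ?thesis by (simp add: down_up)
  qed simp
  have 1: "B.gen (A.gen f) x = (\<Sum>k = 1..K. \<Sum>l = 1..L. \<Sum>m = 1..K.
      \<beta> x k l * (\<alpha> (down x k l) m * (f (up (down x k l) m) - f (down x k l)) - \<alpha> x m * (f (up x m) - f x)))"
    unfolding Bx using AD by (intro sum.cong refl) (simp add: right_diff_distrib Ax sum_subtractf sum_distrib_left)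
  have "A.gen (B.gen f) x = (\<Sum>m = 1..K. \<Sum>k = 1..K. \<Sum>l = 1..L.
      \<alpha> x m * (\<beta> (up x m) k l * (f (up (down x k l) m) - f (up x m)) - \<beta> x k l * (f (down x k l) - f x)))"
    unfolding Ax using BU by (intro sum.cong refl) (simp add: right_diff_distrib Bx sum_subtractf sum_distrib_left)
  also have "\<dots> = (\<Sum>k = 1..K. \<Sum>m = 1..K. \<Sum>l = 1..L.
      \<alpha> x m * (\<beta> (up x m) k l * (f (up (down x k l) m) - f (up x m)) - \<beta> x k l * (f (down x k l) - f x)))"
    by (rule sum.swap)
  also have "\<dots> = (\<Sum>k = 1..K. \<Sum>l = 1..L. \<Sum>m = 1..K.
      \<alpha> x m * (\<beta> (up x m) k l * (f (up (down x k l) m) - f (up x m)) - \<beta> x k l * (f (down x k l) - f x)))"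
    by (intro sum.cong refl sum.swap)
  finally have 2: "A.gen (B.gen f) x = \<dots>" .
  define D where "D k l m = \<beta> x k l * \<alpha> (down x k l) m - \<alpha> x m * \<beta> (up x m) k l" for k l m
  \<comment> \<open>The terms in f x cancel, their coefficients being products of rates at
    x.\<close>
  have "B.gen (A.gen f) x - A.gen (B.gen f) x = (\<Sum>k = 1..K. \<Sum>l = 1..L. \<Sum>m = 1..K.
      D k l m * f (up (down x k l) m) + \<beta> x k l * (\<alpha> x m - \<alpha> (down x k l) m) * f (down x k l)
      + \<alpha> x m * (\<beta> (up x m) k l - \<beta> x k l) * f (up x m))"
    unfolding 1 2 sum_subtractf[symmetric] D_def by (intro sum.cong refl) (simp add: algebra_simps)
  also have "\<dots> = (\<Sum>k = 1..K. \<Sum>l = 1..L. \<Sum>m = 1..K. D k l m * f (up (down x k l) m))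
      + (\<Sum>k = 1..K. \<Sum>l = 1..L. \<Sum>m = 1..K. \<beta> x k l * (\<alpha> x m - \<alpha> (down x k l) m) * f (down x k l))
      + (\<Sum>k = 1..K. \<Sum>l = 1..L. \<Sum>m = 1..K. \<alpha> x m * (\<beta> (up x m) k l - \<beta> x k l) * f (up x m))"
    by (simp only: sum.distrib)
  also have "(\<Sum>k = 1..K. \<Sum>l = 1..L. \<Sum>m = 1..K. \<alpha> x m * (\<beta> (up x m) k l - \<beta> x k l) * f (up x m))
      = (\<Sum>m = 1..K. \<alpha> x m * f (up x m))"
  proof -
    have "(\<Sum>k = 1..K. \<Sum>l = 1..L. \<Sum>m = 1..K. \<alpha> x m * (\<beta> (up x m) k l - \<beta> x k l) * f (up x m))
        = (\<Sum>k = 1..K. \<Sum>m = 1..K. \<Sum>l = 1..L. \<alpha> x m * (\<beta> (up x m) k l - \<beta> x k l) * f (up x m))"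
      by (intro sum.cong refl sum.swap)
    also have "\<dots> = (\<Sum>m = 1..K. \<Sum>k = 1..K. \<Sum>l = 1..L. \<alpha> x m * (\<beta> (up x m) k l - \<beta> x k l) * f (up x m))"
      by (rule sum.swap)
    also have "\<dots> = (\<Sum>m = 1..K. \<alpha> x m * f (up x m))"
    proof (intro sum.cong refl)
      fix m assume m: "m \<in> {1..K}"
      have "(\<Sum>k = 1..K. \<Sum>l = 1..L. \<beta> (up x m) k l - \<beta> x k l) = 1" if "\<alpha> x m \<noteq> 0"
        unfolding \<beta>_def by (rule down_rates_up) (use x m L that in \<open>auto simp: \<alpha>_def\<close>)
      then show "(\<Sum>k = 1..K. \<Sum>l = 1..L. \<alpha> x m * (\<beta> (up x m) k l - \<beta> x k l) * f (up x m)) = \<alpha> x m * f (up x m)"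
        by (cases "\<alpha> x m = 0") (simp_all only: sum_distrib_left[symmetric] sum_distrib_right[symmetric], simp_all)
    qed
    finally show ?thesis .
  qed
  also have "(\<Sum>k = 1..K. \<Sum>l = 1..L. \<Sum>m = 1..K. D k l m * f (up (down x k l) m))
      + (\<Sum>k = 1..K. \<Sum>l = 1..L. \<Sum>m = 1..K. \<beta> x k l * (\<alpha> x m - \<alpha> (down x k l) m) * f (down x k l))
      = - (\<Sum>m = 1..K. \<alpha> x m * f x)"
  proof -
    define E where "E k j = real k * qfall q (gap x k) j * (qgap q x (k - 1) - q ^ (gap x k - j))" for k j
    have D_same: "D k (Suc j) k = E k j" if "1 \<le> k" for k j
      unfolding D_def E_def \<alpha>_def \<beta>_def by (rule rates_commutator_same) (use x that in auto)
    have D_other: "D k l m = 0" if "1 \<le> k" "1 \<le> m" "m \<noteq> k" for k l m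
      unfolding D_def \<alpha>_def \<beta>_def using rates_commute[OF x that] by simp
    have "(\<Sum>l = 1..L. \<Sum>m = 1..K. D k l m * f (up (down x k l) m)) = (\<Sum>j<L. E k j * f (down x k j))"
      if k: "k \<in> {1..K}" for k
    proof -
      have "(\<Sum>m = 1..K. D k l m * f (up (down x k l) m)) = (\<Sum>m\<in>{k}. D k l m * f (up (down x k l) m))" for l
        using k by (intro sum.mono_neutral_right) (auto simp: D_other)
      \<comment> \<open>This index shift aligns the first group with the second.\<close>
      moreover have "up (down x k (Suc j)) k = down x k j" for j
        by (auto simp: up_def down_def)
      ultimately show ?thesis using k by (simp add: sum.atLeast1_atMost_eq D_same)
    qed
    moreover have "(\<Sum>l = 1..L. \<Sum>m = 1..K. \<beta> x k l * (\<alpha> x m - \<alpha> (down x k l) m) * f (down x k l))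
        = - (\<Sum>j = 1..<L. E k j * f (down x k j))" if k: "k \<in> {1..K}" for k
    proof -
      have "(\<Sum>m = 1..K. \<beta> x k l * (\<alpha> x m - \<alpha> (down x k l) m) * f (down x k l)) = - (E k l * f (down x k l))"
        if l: "1 \<le> l" for l
      proof (cases "gap x k < l")
        case True
        then show ?thesis by (simp add: \<beta>_def down_rate_eq_0 E_def qfall_eq_0)
      next
        case False
        then have "k < K" using g0[of k] l by force
        have "(\<Sum>m = 1..K. \<beta> x k l * (\<alpha> x m - \<alpha> (down x k l) m) * f (down x k l))
            = \<beta> x k l * (\<Sum>m = 1..K. \<alpha> x m - \<alpha> (down x k l) m) * f (down x k l)"
          by (simp only: sum_distrib_left sum_distrib_right)
        also have "(\<Sum>m = 1..K. \<alpha> x m - \<alpha> (down x k l) m) = (1 - q ^ l) * (q ^ (gap x k - l) - qgap q x (k - 1))"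
          unfolding \<alpha>_def using x k \<open>k < K\<close> False by (intro qtasep_rates_down) auto
        also have "\<beta> x k l * ((1 - q ^ l) * (q ^ (gap x k - l) - qgap q x (k - 1))) = - E k l"
          using power_q_less_1[of l] l by (simp add: \<beta>_def down_rate_def E_def) (simp add: algebra_simps)
        finally show ?thesis by simp
      qed
      then have "(\<Sum>l = 1..L. \<Sum>m = 1..K. \<beta> x k l * (\<alpha> x m - \<alpha> (down x k l) m) * f (down x k l))
          = - (\<Sum>l = 1..L. E k l * f (down x k l))"
        by (simp add: sum_negf)
      \<comment> \<open>The end term l = L vanishes because L exceeds every gap.\<close>
      also have "(\<Sum>l = 1..L. E k l * f (down x k l)) = (\<Sum>l = 1..<L. E k l * f (down x k l))"
        using L[of k] by (intro sum.mono_neutral_right) (auto simp: E_def qfall_eq_0 le_less)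
      finally show ?thesis .
    qed
    ultimately have "(\<Sum>k = 1..K. \<Sum>l = 1..L. \<Sum>m = 1..K. D k l m * f (up (down x k l) m))
      + (\<Sum>k = 1..K. \<Sum>l = 1..L. \<Sum>m = 1..K. \<beta> x k l * (\<alpha> x m - \<alpha> (down x k l) m) * f (down x k l))
      = (\<Sum>k = 1..K. (\<Sum>j<L. E k j * f (down x k j)) - (\<Sum>j = 1..<L. E k j * f (down x k j)))"
      by (simp add: sum_subtractf sum_negf)
    \<comment> \<open>Only j = 0 survives, and \<open>down x k 0\<close> is x.\<close>
    also have "\<dots> = (\<Sum>k = 1..K. E k 0 * f x)"
      using L[of 0] by (intro sum.cong refl)
        (simp add: lessThan_atLeast0 sum.atLeast_Suc_lessThan down_def)
    also have "\<dots> = (\<Sum>k = 1..K. real k * (qgap q x (k - 1) - qgap q x k)) * f x"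
      by (simp only: sum_distrib_right) (intro sum.cong refl, auto simp: E_def qgap_def)
    \<comment> \<open>Summation by parts, for arbitrary M to allow induction.\<close>
    also have "(\<Sum>k = 1..M. real k * (qgap q x (k - 1) - qgap q x k))
        = (\<Sum>n<M. qgap q x n) - real M * qgap q x M" for M
      by (induction M) (simp_all add: algebra_simps)
    also have "(\<Sum>n<K. qgap q x n) - real K * qgap q x K = - (\<Sum>m = 1..K. \<alpha> x m)"
    proof -
      \<comment> \<open>The K copies of this 1 supply the constants in the rates
        \<open>1 - qgap q x n\<close>.\<close>
      have "qgap q x K = 1" using K(1) g0[of K] by (simp add: qgap_def)
      then show ?thesis
        by (simp add: \<alpha>_def sum.atLeast1_atMost_eq qtasep_rate_eq sum_subtractf)
    qed
    finally show ?thesis by (simp add: sum_distrib_right)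
  qed
  finally show ?thesis
    by (simp add: Ax right_diff_distrib sum_subtractf)
qed

text \<open>The 1 added to the size accounts for the free first particle in the rate bound and also
  makes \<phi> positive.\<close>

sublocale intertwined_rates XX "qtasep_Q q" "back_Q q" "\<lambda>x. - config_size x" config_size
  "\<lambda>x. 1 + real_of_int (config_size x)"
proof
  fix x assume x: "x \<in> XX"
  show "0 \<le> config_size x" "0 < 1 + real_of_int (config_size x)"
    using config_size_nonneg[OF x] by simp_all
  show "exit_rate XX (qtasep_Q q) x \<le> 1 + real_of_int (config_size x)" by (rule exit_rate_le) fact
  show "1 + real_of_int (config_size y) = 1 + real_of_int (config_size x) + 1"
    if "qtasep_Q q x y \<noteq> 0" for y
    using that x by (auto elim!: qtasep_Q_nonzeroE simp: config_size_up)
  show "B.gen (A.gen f) x - A.gen (B.gen f) x = A.gen f x" for f by (rule commutator) fact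
qed

end

theorem theorem5p6:
  fixes q t \<tau> :: real
  assumes "0 \<le> q" and "q < 1" and "0 \<le> t" and "0 \<le> \<tau>"
    and "x \<in> XX" and "z \<in> XX"
  shows "(\<Sum>\<^sub>\<infinity> y\<in>XX. qtasep_sg q t x y * back_sg q \<tau> y z)
       = (\<Sum>\<^sub>\<infinity> y\<in>XX. back_sg q \<tau> x y * qtasep_sg q (exp (- \<tau>) * t) y z)"
proof -
  interpret q_parameter q by unfold_locales fact+
  show ?thesis
    unfolding qtasep_sg_def back_sg_def by (rule semigroup_intertwining) fact+
qed

end
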